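(* Let $\varepsilon \in (0,1)$ and $\gamma > 1$. Let $X_1, X_2, \ldots$ be a sequence of i.i.d. random variables on a probability space $(\Omega, \mathscr{F}, \Pr)$ such that $0 \le X_i \le 1$ and $\mathbb{E}[X_i] = \mu \in (0,1)$ for every positive integer $i$. Let $\boldsymbol{n}$ be the random variable $\boldsymbol{n}(\omega) = \min\{ n \in \mathbb{Z} : \sum_{i=1}^n X_i(\omega) \ge \gamma \}$, and define $\widetilde{\boldsymbol{\mu}} = \frac{\gamma}{\boldsymbol{n}}$ and $\widehat{\boldsymbol{\mu}} = \frac{\gamma - 1}{\boldsymbol{n} - 1}$. Define $$\widetilde{\mathscr{Q}}(\varepsilon,\gamma) = (1+\varepsilon)^{-\gamma} \exp\left(\frac{\varepsilon\gamma}{1+\varepsilon}\right) + \left(\frac{\gamma - 1 + \varepsilon}{\gamma - \varepsilon\gamma}\right)^{\gamma} \exp\left(\frac{1 - \varepsilon\gamma - \varepsilon}{1-\varepsilon}\right)$$ and $$\widehat{\mathscr{Q}}(\varepsilon,\gamma) = (1+\varepsilon)^{-\gamma} \exp\left(\frac{\varepsilon\gamma}{1+\varepsilon}\right) + \left(\frac{\gamma - 1}{\gamma - \varepsilon\gamma}\right)^{\gamma} \exp\left(\frac{1 - \varepsilon\gamma}{1-\varepsilon}\right).$$ Then the following hold. (I) $\Pr\left\{ \left| \frac{\widetilde{\boldsymbol{\mu}} - \mu}{\mu} \right| \ge \varepsilon \right\} \le \widetilde{\mathscr{Q}}(\varepsilon,\gamma)$ provided that $\gamma > \frac{1-\varepsilon}{\varepsilon}$.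 (II) $\Pr\left\{ \left| \frac{\widehat{\boldsymbol{\mu}} - \mu}{\mu} \right| \ge \varepsilon \right\} \le \widehat{\mathscr{Q}}(\varepsilon,\gamma)$ provided that $\gamma > \frac{1}{\varepsilon}$. (III) $\widetilde{\mathscr{Q}}(\varepsilon,\gamma)$ is monotone decreasing with respect to $\gamma > \frac{1-\varepsilon}{\varepsilon}$. Moreover, for any $\delta \in (0,1)$ there exists a unique number $\widetilde{\gamma} > \frac{1-\varepsilon}{\varepsilon}$ such that $\widetilde{\mathscr{Q}}(\varepsilon,\widetilde{\gamma}) = \delta$. (IV) $\widehat{\mathscr{Q}}(\varepsilon,\gamma)$ is monotone decreasing with respect to $\gamma > \frac{1}{\varepsilon}$. Moreover, for any $\delta \in (0,1)$ there exists a unique number $\widehat{\gamma} > \frac{1}{\varepsilon}$ such that $\widehat{\mathscr{Q}}(\varepsilon,\widehat{\gamma}) = \delta$. (V) For any $\delta \in (0,1)$, with $\widetilde{\gamma}$ and $\widehat{\gamma}$ (depending on $\varepsilon$ and $\delta$) as in (III) and (IV), $$(1-\varepsilon)\widehat{\gamma} < \widetilde{\gamma} < \widehat{\gamma} < \frac{(1+\varepsilon)\ln\frac{2}{\delta}}{(1+\varepsilon)\ln(1+\varepsilon) - \varepsilon} < \frac{(1+\varepsilon)\ln\frac{2}{\delta}}{(2\ln 2 - 1)\varepsilon^2} < \frac{4(e-2)(1+\varepsilon)\ln\frac{2}{\delta}}{\varepsilon^2}.$$ Moreover, $$\lim_{\delta \to 0} \frac{\widetilde{\gamma}}{\left[\ln(1+\varepsilon)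 - \frac{\varepsilon}{1+\varepsilon}\right]^{-1} \ln\frac{2}{\delta}} = \lim_{\varepsilon \to 0} \frac{\widetilde{\gamma}}{\left[\ln(1+\varepsilon) - \frac{\varepsilon}{1+\varepsilon}\right]^{-1} \ln\frac{2}{\delta}} = 1,$$ where the first limit is taken with $\varepsilon \in (0,1)$ fixed and the second with $\delta \in (0,1)$ fixed. (VI) For $\varrho > \frac{\mu}{\gamma}$, $$\Pr\left\{ \boldsymbol{n} \ge \frac{\gamma(1+\varrho)}{\mu} \right\} \le \left(1+\varrho-\frac{\mu}{\gamma}\right)^{\left(1+\varrho-\frac{\mu}{\gamma}\right)\frac{\gamma}{\mu}} \left(\frac{1-\mu}{1+\varrho-\frac{\mu}{\gamma}-\mu}\right)^{\left(1+\varrho-\frac{\mu}{\gamma}-\mu\right)\frac{\gamma}{\mu}}.$$ (VII) For $0 < \varrho < 1-\mu$, $$\Pr\left\{ \boldsymbol{n} \le \frac{\gamma(1-\varrho)}{\mu} \right\} \le (1-\varrho)^{(1-\varrho)\frac{\gamma}{\mu}} \left(\frac{1-\mu}{1-\varrho-\mu}\right)^{(1-\varrho-\mu)\frac{\gamma}{\mu}}.$$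
   Context: Sampling stops at the first sample size $\boldsymbol{n}$ for which the sample sum is at least $\gamma$. $\ln$ is the natural logarithm and $e$ is its base. In (III)–(V) the formulas for $\widetilde{\mathscr{Q}}$ and $\widehat{\mathscr{Q}}$ are regarded as functions of the real variable $\gamma$ on the indicated ranges. *)

theory Defs
  imports "HOL-Probability.Probability"
begin

text \<open>Samples are indexed from 1. The value is infinity on the (null) set of outcomes whose
  partial sums never reach \<open>\<gamma>\<close>. Non-positive sample sizes need not be considered:
  their sums are empty, and \<open>\<gamma> > 0\<close>.\<close>

definition sample_size :: "real \<Rightarrow> (nat \<Rightarrow> 'a \<Rightarrow> real) \<Rightarrow> 'a \<Rightarrow> enat" where
  "sample_size \<gamma> X \<omega> = Inf {enat n | n. (\<Sum>i=1..n. X i \<omega>) \<ge> \<gamma>}"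

text \<open>Both estimators read a quotient by an infinite sample size as 0.\<close>

definition mu_tilde :: "real \<Rightarrow> (nat \<Rightarrow> 'a \<Rightarrow> real) \<Rightarrow> 'a \<Rightarrow> real" where
  "mu_tilde \<gamma> X \<omega> = (case sample_size \<gamma> X \<omega> of enat n \<Rightarrow> \<gamma> / real n | \<infinity> \<Rightarrow> 0)"

definition mu_hat :: "real \<Rightarrow> (nat \<Rightarrow> 'a \<Rightarrow> real) \<Rightarrow> 'a \<Rightarrow> real" where
  "mu_hat \<gamma> X \<omega> = (case sample_size \<gamma> X \<omega> of enat n \<Rightarrow> (\<gamma> - 1) / (real n - 1) | \<infinity> \<Rightarrow> 0)"

definition Q_tilde :: "real \<Rightarrow> real \<Rightarrow> real" where
  "Q_tilde \<epsilon> \<gamma> =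
     (1 + \<epsilon>) powr (- \<gamma>) * exp (\<epsilon> * \<gamma> / (1 + \<epsilon>))
     + ((\<gamma> - 1 + \<epsilon>) / (\<gamma> - \<epsilon> * \<gamma>)) powr \<gamma> * exp ((1 - \<epsilon> * \<gamma> - \<epsilon>) / (1 - \<epsilon>))"

definition Q_hat :: "real \<Rightarrow> real \<Rightarrow> real" where
  "Q_hat \<epsilon> \<gamma> =
     (1 + \<epsilon>) powr (- \<gamma>) * exp (\<epsilon> * \<gamma> / (1 + \<epsilon>))
     + ((\<gamma> - 1) / (\<gamma> - \<epsilon> * \<gamma>)) powr \<gamma> * exp ((1 - \<epsilon> * \<gamma>) / (1 - \<epsilon>))"

text \<open>Both descriptions are meant for \<open>0 < \<epsilon> < 1\<close> and \<open>0 < \<delta> < 1\<close>, where the solution is unique.\<close>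

definition gamma_tilde :: "real \<Rightarrow> real \<Rightarrow> real" where
  "gamma_tilde \<epsilon> \<delta> = (THE \<gamma>. \<gamma> > (1 - \<epsilon>) / \<epsilon> \<and> Q_tilde \<epsilon> \<gamma> = \<delta>)"

definition gamma_hat :: "real \<Rightarrow> real \<Rightarrow> real" where
  "gamma_hat \<epsilon> \<delta> = (THE \<gamma>. \<gamma> > 1 / \<epsilon> \<and> Q_hat \<epsilon> \<gamma> = \<delta>)"

end

theory Submission imports Defs "HOL-Real_Asymp.Real_Asymp" begin

text \<open>
  Stopping late means that a partial sum of fixed length is below \<open>\<gamma>\<close>, stopping early that one is at
  least \<open>\<gamma>\<close>. By convexity \<open>exp (t * X)\<close> has expectation at most \<open>1 - \<mu> + \<mu> * exp t\<close>, and Chernoff's method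
  with the optimal \<open>t\<close> gives (VI) and (VII). Weakening \<open>1 - \<mu> + \<mu> * exp t \<le> exp (\<mu> * (exp t - 1))\<close> turns
  these into Poisson tails that no longer depend on \<open>\<mu>\<close>, which gives (I) and (II).

  Both error bounds have the form \<open>exp (- \<gamma> * c) + exp (g s \<gamma>)\<close> with
  \<open>c = ln (1 + \<epsilon>) - \<epsilon> / (1 + \<epsilon>)\<close>. With \<open>d = ln (1 - \<epsilon>) + \<epsilon> / (1 - \<epsilon>) > c\<close> one has
  \<open>- \<gamma> * d \<le> g s \<gamma> < s * \<epsilon> - \<gamma> * d\<close>. The upper estimate together with a lower bound on \<open>d - c\<close> makes the second
  term smaller than the first at \<open>\<gamma> = ln (2 / \<delta>) / c\<close>, hence the upper bound on the solutions. The
  lower estimate gives \<open>\<gamma> * d \<ge> ln (2 / \<delta>)\<close>, so the normalised solution lies between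
  \<open>c / d\<close> and \<open>1\<close>, which settles \<open>\<epsilon> \<rightarrow> 0\<close>; for \<open>\<delta> \<rightarrow> 0\<close> it suffices that the first term
  is below \<open>\<delta>\<close>.
\<close>

section \<open>Estimates of logarithms and of the exponential rates\<close>

lemma ln_less_minus_one:
  fixes x :: real
  assumes "0 < x" "x \<noteq> 1"
  shows "ln x < x - 1"
  using ln_le_minus_one[of x] ln_eq_minus_one[of x] assms by fastforce

lemma ln_greater_one_minus_inverse:
  fixes x :: real
  assumes "0 < x" "x \<noteq> 1"
  shows "1 - 1 / x < ln x"
  using ln_less_minus_one[of "1 / x"] assms by (simp add: ln_div)

text \<open>The difference of the sides vanishes at 0 and has a positive derivative. This gives both
  the numerical bound for \<open>ln 2\<close> and the sign of the derivative in
  \<open>one_plus_times_ln_greater\<close>.\<close>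

lemma ln_one_plus_greater_Pade:
  fixes x :: real
  assumes "0 < x"
  shows "2 * x / (2 + x) < ln (1 + x)"
proof -
  let ?f = "\<lambda>x::real. ln (1 + x) - 2 * x / (2 + x)"
  have "?f 0 < ?f x"
  proof (rule DERIV_pos_imp_increasing_open[OF assms])
    fix y :: real
    assume y: "0 < y"
    have eq: "1 / (1 + y) - 4 / (2 + y)\<^sup>2 = y\<^sup>2 / ((1 + y) * (2 + y)\<^sup>2)"
      using y by (simp add: divide_simps) (simp add: algebra_simps power2_eq_square)
    have "(?f has_real_derivative y\<^sup>2 / ((1 + y) * (2 + y)\<^sup>2)) (at y)"
      unfolding eq[symmetric]
      using y by (auto intro!: derivative_eq_intros simp: power2_eq_square)
    moreover have "0 < y\<^sup>2 / ((1 + y) * (2 + y)\<^sup>2)"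
      using y by simp
    ultimately show "\<exists>d. (?f has_real_derivative d) (at y) \<and> d > 0"
      by blast
  next
    show "continuous_on {0..x} ?f"
      by (intro continuous_intros) auto
  qed
  then show ?thesis by simp
qed

text \<open>Splitting 2 into \<open>4 / 3 * (3 / 2)\<close> gives \<open>2 / 7 + 2 / 5\<close>. The
  same estimate applied directly at 1 yields only \<open>2 / 3\<close>, too weak for the last
  inequality of \<open>sample_size_bounds\<close>.\<close>

lemma ln_2_greater: "ln 2 > (24 / 35 :: real)"
proof -
  have "ln 2 = ln (1 + 1 / 3) + ln (1 + 1 / 2 :: real)"
    using ln_mult[of "1 + 1 / 3 :: real" "1 + 1 / 2"] by simp
  then show ?thesis
    using ln_one_plus_greater_Pade[of "1 / 3"] ln_one_plus_greater_Pade[of "1 / 2"] by simp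
qed

lemma exp_1_greater: "exp 1 > (268 / 100 :: real)"
proof -
  \<comment> \<open>\<open>41 / 32\<close> is the quadratic Taylor polynomial of \<open>exp\<close>
    at \<open>1 / 4\<close>; taking the fourth power keeps the truncation error small.\<close>
  have "(41 / 32) ^ 4 \<le> exp (1 / 4 :: real) ^ 4"
    using exp_lower_Taylor_quadratic[of "1 / 4 :: real"] by (intro power_mono) (auto simp: power2_eq_square)
  also have "\<dots> = exp 1"
    by (simp add: exp_of_nat_mult[symmetric])
  finally show ?thesis by (simp add: power_divide)
qed

text \<open>The decay rate per unit of \<open>\<gamma>\<close> for overestimation:
  \<open>- (\<gamma> * upper_rate \<epsilon>)\<close> is the Poisson exponent at mean
  \<open>\<gamma> / (1 + \<epsilon>)\<close>. Likewise \<open>lower_rate\<close> belongs to mean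
  \<open>\<gamma> / (1 - \<epsilon>)\<close> and is \<open>upper_rate\<close> at
  \<open>- \<epsilon>\<close>.\<close>

definition upper_rate :: "real \<Rightarrow> real" where
  "upper_rate \<epsilon> = ln (1 + \<epsilon>) - \<epsilon> / (1 + \<epsilon>)"

definition lower_rate :: "real \<Rightarrow> real" where
  "lower_rate \<epsilon> = ln (1 - \<epsilon>) + \<epsilon> / (1 - \<epsilon>)"

text \<open>The minimum over \<open>t\<close> of \<open>l * (exp t - 1) - t * \<gamma>\<close>, i.e. the logarithm of the Chernoff bound for
  a Poisson variable of mean \<open>l\<close> at \<open>\<gamma>\<close>.\<close>

definition poisson_exponent :: "real \<Rightarrow> real \<Rightarrow> real" where
  "poisson_exponent \<gamma> l = \<gamma> * ln (l / \<gamma>) + \<gamma> - l"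

text \<open>The shift \<open>s = 1\<close> gives \<open>Q_tilde\<close> and \<open>s = 1 / (1 - \<epsilon>)\<close> gives \<open>Q_hat\<close>; the range of \<open>\<gamma>\<close> becomes
  \<open>\<gamma> > s * (1 - \<epsilon>) / \<epsilon>\<close> in both cases.\<close>

definition Q_shift :: "real \<Rightarrow> real \<Rightarrow> real \<Rightarrow> real" where
  "Q_shift \<epsilon> s \<gamma> =
     exp (- (\<gamma> * upper_rate \<epsilon>)) + exp (poisson_exponent \<gamma> (\<gamma> / (1 - \<epsilon>) - s))"

lemma upper_rate_pos: "0 < \<epsilon> \<Longrightarrow> 0 < upper_rate \<epsilon>"
  using ln_greater_one_minus_inverse[of "1 + \<epsilon>"] by (simp add: upper_rate_def field_simps)

lemma lower_rate_pos:
  assumes "0 < \<epsilon>" "\<epsilon> < 1"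
  shows "0 < lower_rate \<epsilon>"
  using ln_greater_one_minus_inverse[of "1 - \<epsilon>"] assms by (simp add: lower_rate_def field_simps)

text \<open>Ensures that \<open>ln (2 / \<delta>) / upper_rate \<epsilon>\<close> lies beyond
  \<open>(1 + \<epsilon>) / \<epsilon>\<^sup>2\<close>, and so inside the range of
  \<open>Q_hat\<close>.\<close>

lemma upper_rate_less:
  assumes "0 < \<epsilon>"
  shows "upper_rate \<epsilon> < \<epsilon>\<^sup>2 / (2 * (1 + \<epsilon>))"
proof -
  let ?f = "\<lambda>x::real. x\<^sup>2 / (2 * (1 + x)) - (ln (1 + x) - x / (1 + x))"
  have "?f 0 < ?f \<epsilon>"
  proof (rule DERIV_pos_imp_increasing_open[OF assms])
    fix y :: real
    assume y: "0 < y"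
    have eq: "(2 * y * (2 * (1 + y)) - y\<^sup>2 * 2) / (2 * (1 + y))\<^sup>2 - (1 / (1 + y) - 1 / (1 + y)\<^sup>2)
        = y\<^sup>2 / (2 * (1 + y)\<^sup>2)"
      using y by (simp add: divide_simps) (simp add: algebra_simps power2_eq_square)
    have "(?f has_real_derivative y\<^sup>2 / (2 * (1 + y)\<^sup>2)) (at y)"
      unfolding eq[symmetric]
      using y by (auto intro!: derivative_eq_intros simp: power2_eq_square)
    moreover have "0 < y\<^sup>2 / (2 * (1 + y)\<^sup>2)"
      using y by simp
    ultimately show "\<exists>d. (?f has_real_derivative d) (at y) \<and> d > 0"
      by blast
  next
    show "continuous_on {0..\<epsilon>} ?f"
      by (intro continuous_intros) auto
  qed
  then show ?thesis by (simp add: upper_rate_def)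
qed

text \<open>The left side is chosen so that multiplying it by
  \<open>(1 + \<epsilon>) / \<epsilon>\<^sup>2\<close> gives
  \<open>\<epsilon> / (1 - \<epsilon>)\<close>, the excess that the shift in \<open>Q_hat\<close>
  adds to the exponent.\<close>

lemma rate_gap:
  assumes "0 < \<epsilon>" "\<epsilon> < 1"
  shows "\<epsilon> ^ 3 / (1 - \<epsilon>\<^sup>2) < lower_rate \<epsilon> - upper_rate \<epsilon>"
proof -
  have sq: "y\<^sup>2 < 1" if "0 \<le> y" "y < 1" for y :: real
    using that by (simp add: power_less_one_iff)
  \<comment> \<open>The difference of the two sides, once the fractions are combined by the two
    identities at the end of the proof.\<close>
  let ?f = "\<lambda>x::real. x / (1 - x\<^sup>2) + x - ln (1 + x) + ln (1 - x)"
  have "?f 0 < ?f \<epsilon>"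
  proof (rule DERIV_pos_imp_increasing_open[OF assms(1)])
    fix y :: real
    assume y: "0 < y" "y < \<epsilon>"
    have y2: "1 - y\<^sup>2 > 0" using sq[of y] y assms by simp
    have eq: "(1 + y\<^sup>2) / (1 - y\<^sup>2)\<^sup>2 + 1 - 1 / (1 + y) - 1 / (1 - y) = (y\<^sup>2 + y ^ 4) / (1 - y\<^sup>2)\<^sup>2"
    proof -
      have cancel: "2 / r = 2 * r / r\<^sup>2" if "r > 0" for r :: real
        using that by (simp add: power2_eq_square)
      have "1 / (1 + y) + 1 / (1 - y) = 2 / (1 - y\<^sup>2)"
        using y y2 assms by (simp add: field_simps power2_eq_square)
      also have "\<dots> = 2 * (1 - y\<^sup>2) / (1 - y\<^sup>2)\<^sup>2"
        using cancel[OF y2] by simp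
      finally have "1 / (1 + y) + 1 / (1 - y) = 2 * (1 - y\<^sup>2) / (1 - y\<^sup>2)\<^sup>2" .
      moreover have "(1 + y\<^sup>2) / (1 - y\<^sup>2)\<^sup>2 + 1 - 2 * (1 - y\<^sup>2) / (1 - y\<^sup>2)\<^sup>2
          = (y\<^sup>2 + y ^ 4) / (1 - y\<^sup>2)\<^sup>2"
      proof -
        have "y\<^sup>2 + y ^ 4 = (1 + y\<^sup>2) + (1 - y\<^sup>2)\<^sup>2 - 2 * (1 - y\<^sup>2)"
          by algebra
        then show ?thesis
          using y2 by (simp only: diff_divide_distrib add_divide_distrib) simp
      qed
      ultimately show ?thesis by linarith
    qed
    have "(?f has_real_derivative (y\<^sup>2 + y ^ 4) / (1 - y\<^sup>2)\<^sup>2) (at y)"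
      unfolding eq[symmetric]
      using y y2 assms by (auto intro!: derivative_eq_intros simp: power2_eq_square)
    moreover have "0 < (y\<^sup>2 + y ^ 4) / (1 - y\<^sup>2)\<^sup>2"
      using y y2 by (simp add: add_pos_pos)
    ultimately show "\<exists>d. (?f has_real_derivative d) (at y) \<and> d > 0"
      by blast
  next
    show "continuous_on {0..\<epsilon>} ?f"
      using assms sq by (intro continuous_intros) (force simp: power2_eq_1_iff)+
  qed
  moreover have "\<epsilon> / (1 - \<epsilon>) + \<epsilon> / (1 + \<epsilon>) = 2 * \<epsilon> / (1 - \<epsilon>\<^sup>2)"
    using assms by (simp add: field_simps power2_eq_square)
  moreover have "\<epsilon> ^ 3 / (1 - \<epsilon>\<^sup>2) = \<epsilon> / (1 - \<epsilon>\<^sup>2) - \<epsilon>"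
    using sq[of \<epsilon>] assms by (simp add: field_simps power2_eq_square power3_eq_cube)
  ultimately show ?thesis
    by (simp add: lower_rate_def upper_rate_def)
qed

section \<open>Monotonicity of the error bounds\<close>

lemma powr_times_exp_eq_exp_poisson_exponent:
  assumes "0 < \<gamma>" "0 < l"
  shows "(l / \<gamma>) powr \<gamma> * exp (\<gamma> - l) = exp (poisson_exponent \<gamma> l)"
  using assms by (simp add: powr_def poisson_exponent_def exp_add[symmetric] add_diff_eq)

lemma powr_times_exp_eq_exp_upper_rate:
  assumes "0 < \<epsilon>"
  shows "(1 + \<epsilon>) powr (- \<gamma>) * exp (\<epsilon> * \<gamma> / (1 + \<epsilon>)) = exp (- (\<gamma> * upper_rate \<epsilon>))"
  using assms by (simp add: powr_def exp_add[symmetric] upper_rate_def algebra_simps)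

lemma Q_tilde_eq:
  assumes "0 < \<epsilon>" "\<epsilon> < 1" "1 - \<epsilon> < \<gamma>"
  shows "Q_tilde \<epsilon> \<gamma> = Q_shift \<epsilon> 1 \<gamma>"
proof -
  have "(\<gamma> - 1 + \<epsilon>) / (\<gamma> - \<epsilon> * \<gamma>) = (\<gamma> / (1 - \<epsilon>) - 1) / \<gamma>"
    and "(1 - \<epsilon> * \<gamma> - \<epsilon>) / (1 - \<epsilon>) = \<gamma> - (\<gamma> / (1 - \<epsilon>) - 1)"
    using assms by (simp_all add: field_simps)
  moreover have "0 < \<gamma> / (1 - \<epsilon>) - 1"
    using assms by simp
  ultimately show ?thesis
    using assms powr_times_exp_eq_exp_poisson_exponent[of \<gamma> "\<gamma> / (1 - \<epsilon>) - 1"]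
      powr_times_exp_eq_exp_upper_rate[of \<epsilon> \<gamma>]
    by (simp only: Q_tilde_def Q_shift_def)
qed

lemma Q_hat_eq:
  assumes "0 < \<epsilon>" "\<epsilon> < 1" "1 < \<gamma>"
  shows "Q_hat \<epsilon> \<gamma> = Q_shift \<epsilon> (1 / (1 - \<epsilon>)) \<gamma>"
proof -
  have "(\<gamma> - 1) / (\<gamma> - \<epsilon> * \<gamma>) = (\<gamma> / (1 - \<epsilon>) - 1 / (1 - \<epsilon>)) / \<gamma>"
    by (simp add: diff_divide_distrib[symmetric] algebra_simps)
  moreover have "\<gamma> = (\<gamma> - \<epsilon> * \<gamma>) / (1 - \<epsilon>)"
    using assms by (simp add: field_simps)
  then have "(1 - \<epsilon> * \<gamma>) / (1 - \<epsilon>) = \<gamma> - (\<gamma> / (1 - \<epsilon>) - 1 / (1 - \<epsilon>))"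
    by (simp add: diff_divide_distrib)
  moreover have "0 < \<gamma> / (1 - \<epsilon>) - 1 / (1 - \<epsilon>)"
    using assms by (simp add: divide_strict_right_mono)
  ultimately show ?thesis
    using assms powr_times_exp_eq_exp_poisson_exponent[of \<gamma> "\<gamma> / (1 - \<epsilon>) - 1 / (1 - \<epsilon>)"]
      powr_times_exp_eq_exp_upper_rate[of \<epsilon> \<gamma>]
    by (simp only: Q_hat_def Q_shift_def)
qed

text \<open>The admissible range of \<open>\<gamma>\<close> consists of the values for which the
  shifted Poisson mean exceeds \<open>\<gamma>\<close>, so that the event of late stopping is a
  genuine lower tail.\<close>

lemma threshold_less_iff:
  fixes \<epsilon> s \<gamma> :: real
  assumes "0 < \<epsilon>" "\<epsilon> < 1"
  shows "s * (1 - \<epsilon>) / \<epsilon> < \<gamma> \<longleftrightarrow> \<gamma> < \<gamma> / (1 - \<epsilon>) - s"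
    and "s * (1 - \<epsilon>) / \<epsilon> \<le> \<gamma> \<longleftrightarrow> \<gamma> \<le> \<gamma> / (1 - \<epsilon>) - s"
  using assms by (simp_all add: field_simps)

text \<open>The slope in the mean is \<open>\<gamma> / l - 1\<close>, which is not positive once
  \<open>\<gamma> \<le> l\<close>; concavity of \<open>ln\<close> makes the decrease strict.\<close>

lemma poisson_exponent_decreasing:
  assumes "0 < \<gamma>" "\<gamma> \<le> l" "l < l'"
  shows "poisson_exponent \<gamma> l' < poisson_exponent \<gamma> l"
proof -
  have "ln (l' / l) < l' / l - 1"
    using assms by (intro ln_less_minus_one) auto
  then have "\<gamma> * ln (l' / l) < \<gamma> * (l' / l - 1)"
    using assms by simp
  also have "\<gamma> * (l' / l - 1) = (\<gamma> / l) * (l' - l)"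
    using assms by (simp add: field_simps)
  also have "\<dots> \<le> 1 * (l' - l)"
    using assms by (intro mult_right_mono) auto
  finally show ?thesis
    using assms by (simp add: poisson_exponent_def ln_div algebra_simps)
qed

lemma poisson_exponent_neg:
  assumes "0 < \<gamma>" "\<gamma> < l"
  shows "poisson_exponent \<gamma> l < 0"
  using poisson_exponent_decreasing[of \<gamma> \<gamma> l] assms by (simp add: poisson_exponent_def)

lemma poisson_exponent_shift_bounds:
  assumes "0 < \<epsilon>" "\<epsilon> < 1" "0 < s" "s * (1 - \<epsilon>) / \<epsilon> < \<gamma>"
  shows "- (\<gamma> * lower_rate \<epsilon>) \<le> poisson_exponent \<gamma> (\<gamma> / (1 - \<epsilon>) - s)"
    and "poisson_exponent \<gamma> (\<gamma> / (1 - \<epsilon>) - s) < s * \<epsilon> - \<gamma> * lower_rate \<epsilon>"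
proof -
  \<comment> \<open>\<open>x\<close> is the relative amount by which the shift lowers the mean
    \<open>\<gamma> / (1 - \<epsilon>)\<close>. The exponent becomes
    \<open>\<gamma> * ln (1 - x) + s - \<gamma> * lower_rate \<epsilon>\<close>, and elementary
    bounds on \<open>ln (1 - x)\<close> give both estimates.\<close>
  define x where "x = s * (1 - \<epsilon>) / \<gamma>"
  have "0 < s * (1 - \<epsilon>) / \<epsilon>" using assms by simp
  then have \<gamma>: "0 < \<gamma>" using assms(4) by linarith
  have x: "0 < x" "x < \<epsilon>"
    using assms \<gamma> by (auto simp: x_def field_simps)
  have ratio: "(\<gamma> / (1 - \<epsilon>) - s) / \<gamma> = (1 - x) / (1 - \<epsilon>)"
    using assms \<gamma> by (simp add: x_def field_simps)
  have "poisson_exponent \<gamma> (\<gamma> / (1 - \<epsilon>) - s)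
      = \<gamma> * (ln (1 - x) - ln (1 - \<epsilon>)) + \<gamma> - (\<gamma> / (1 - \<epsilon>) - s)"
    unfolding poisson_exponent_def ratio using x assms by (simp add: ln_div)
  also have "\<dots> = \<gamma> * ln (1 - x) + s - \<gamma> * lower_rate \<epsilon>"
    using assms by (simp add: lower_rate_def field_simps)
  finally have eq: "poisson_exponent \<gamma> (\<gamma> / (1 - \<epsilon>) - s)
      = \<gamma> * ln (1 - x) + s - \<gamma> * lower_rate \<epsilon>" .
  have "ln (1 - x) < - x"
    using ln_less_minus_one[of "1 - x"] x assms by simp
  then have "\<gamma> * ln (1 - x) < \<gamma> * - x"
    using \<gamma> by (rule mult_strict_left_mono)
  also have "\<gamma> * - x = s * \<epsilon> - s"
    using \<gamma> by (simp add: x_def) (simp add: algebra_simps)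
  finally show "poisson_exponent \<gamma> (\<gamma> / (1 - \<epsilon>) - s) < s * \<epsilon> - \<gamma> * lower_rate \<epsilon>"
    unfolding eq by simp
  \<comment> \<open>This is where the threshold enters: it says \<open>x < \<epsilon>\<close>, so
    \<open>(1 - \<epsilon>) / (1 - x)\<close> is at most 1.\<close>
  have "- s \<le> - (s * (1 - \<epsilon>) / (1 - x))"
    using x assms by (simp add: field_simps)
  also have "\<dots> = \<gamma> * (1 - 1 / (1 - x))"
  proof -
    have "\<gamma> * (1 - 1 / (1 - x)) = - (\<gamma> * x / (1 - x))"
      using x assms by (simp add: field_simps)
    then show ?thesis
      using \<gamma> by (simp add: x_def)
  qed
  also have "\<dots> \<le> \<gamma> * ln (1 - x)"
    using ln_greater_one_minus_inverse[of "1 - x"] x assms \<gamma> by (intro mult_left_mono) auto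
  finally show "- (\<gamma> * lower_rate \<epsilon>) \<le> poisson_exponent \<gamma> (\<gamma> / (1 - \<epsilon>) - s)"
    unfolding eq by simp
qed

lemma poisson_exponent_has_derivative:
  assumes "(f has_real_derivative d) (at \<gamma>)" "0 < \<gamma>" "0 < f \<gamma>"
  shows "((\<lambda>\<gamma>. poisson_exponent \<gamma> (f \<gamma>)) has_real_derivative
    ln (f \<gamma> / \<gamma>) + \<gamma> * d / f \<gamma> - d) (at \<gamma>)"
proof -
  have "1 * ln (f \<gamma> / \<gamma>) + 1 / (f \<gamma> / \<gamma>) * ((d * \<gamma> - f \<gamma> * 1) / (\<gamma> * \<gamma>)) * \<gamma> + 1 - d
      = ln (f \<gamma> / \<gamma>) + \<gamma> * d / f \<gamma> - d"
    using assms(2,3) by (simp add: field_simps)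
  moreover have "((\<lambda>\<gamma>. poisson_exponent \<gamma> (f \<gamma>)) has_real_derivative
      1 * ln (f \<gamma> / \<gamma>) + 1 / (f \<gamma> / \<gamma>) * ((d * \<gamma> - f \<gamma> * 1) / (\<gamma> * \<gamma>)) * \<gamma> + 1 - d) (at \<gamma>)"
    unfolding poisson_exponent_def using assms
    by (auto intro!: derivative_eq_intros)
  ultimately show ?thesis by (simp only:)
qed

lemma poisson_exponent_shift_has_derivative:
  assumes "\<epsilon> < 1" "0 < \<gamma>" "0 < \<gamma> / (1 - \<epsilon>) - s"
  shows "((\<lambda>\<gamma>. poisson_exponent \<gamma> (\<gamma> / (1 - \<epsilon>) - s)) has_real_derivative
    ln ((\<gamma> / (1 - \<epsilon>) - s) / \<gamma>) + \<gamma> / (1 - \<epsilon>) / (\<gamma> / (1 - \<epsilon>) - s) - 1 / (1 - \<epsilon>)) (at \<gamma>)"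
proof -
  have "((\<lambda>\<gamma>. \<gamma> / (1 - \<epsilon>) - s) has_real_derivative 1 / (1 - \<epsilon>)) (at \<gamma>)"
    using assms by (auto intro!: derivative_eq_intros)
  from poisson_exponent_has_derivative[OF this] show ?thesis
    using assms by simp
qed

lemma poisson_exponent_shift_continuous_on:
  assumes "0 < \<epsilon>" "\<epsilon> < 1" "0 < s" "s * (1 - \<epsilon>) / \<epsilon> \<le> a"
  shows "continuous_on {a..b} (\<lambda>\<gamma>. poisson_exponent \<gamma> (\<gamma> / (1 - \<epsilon>) - s))"
proof -
  have *: "0 < \<gamma> \<and> 0 < \<gamma> / (1 - \<epsilon>) - s" if "a \<le> \<gamma>" for \<gamma>
  proof -
    have "0 < s * (1 - \<epsilon>) / \<epsilon>" using assms by simp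
    with that assms threshold_less_iff(2)[of \<epsilon> s \<gamma>] show ?thesis by linarith
  qed
  show ?thesis
    by (intro DERIV_atLeastAtMost_imp_continuous_on exI)
      (use * assms in \<open>blast intro: poisson_exponent_shift_has_derivative\<close>)
qed

text \<open>Here the mean moves together with \<open>\<gamma>\<close>, so monotonicity in the mean
  does not suffice. The total derivative is
  \<open>ln (l / \<gamma>) - (l + s) / \<gamma> * (1 - \<gamma> / l)\<close>, negative by
  \<open>ln y < y - 1\<close>.\<close>

lemma poisson_exponent_shift_decreasing:
  assumes "0 < \<epsilon>" "\<epsilon> < 1" "0 < s" "s * (1 - \<epsilon>) / \<epsilon> \<le> a" "a < b"
  shows "poisson_exponent b (b / (1 - \<epsilon>) - s) < poisson_exponent a (a / (1 - \<epsilon>) - s)"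
proof (rule DERIV_neg_imp_decreasing_open[OF assms(5)])
  show "continuous_on {a..b} (\<lambda>\<gamma>. poisson_exponent \<gamma> (\<gamma> / (1 - \<epsilon>) - s))"
    by (rule poisson_exponent_shift_continuous_on) fact+
next
  fix \<gamma> assume \<gamma>: "a < \<gamma>" "\<gamma> < b"
  define l where "l = \<gamma> / (1 - \<epsilon>) - s"
  have "0 < s * (1 - \<epsilon>) / \<epsilon>" using assms by simp
  then have "0 < \<gamma>" using \<gamma> assms by linarith
  moreover have "\<gamma> < l"
    using \<gamma> assms threshold_less_iff(1)[of \<epsilon> s \<gamma>] by (simp add: l_def)
  ultimately have pos: "0 < \<gamma>" "\<gamma> < l" by auto
  have slope: "1 / (1 - \<epsilon>) = (l + s) / \<gamma>"
    using pos assms by (simp add: l_def field_simps)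
  have "ln (l / \<gamma>) < l / \<gamma> - 1"
    using pos by (intro ln_less_minus_one) auto
  also have "\<dots> = (l / \<gamma>) * (1 - \<gamma> / l)"
    using pos by (simp add: field_simps)
  also have "\<dots> \<le> ((l + s) / \<gamma>) * (1 - \<gamma> / l)"
    using pos assms by (intro mult_right_mono divide_right_mono) auto
  also have "\<dots> = 1 / (1 - \<epsilon>) - \<gamma> / (1 - \<epsilon>) / l"
    unfolding slope[symmetric] using pos by (simp add: right_diff_distrib)
  finally have "ln (l / \<gamma>) + \<gamma> / (1 - \<epsilon>) / l - 1 / (1 - \<epsilon>) < 0"
    by simp
  moreover have "((\<lambda>\<gamma>. poisson_exponent \<gamma> (\<gamma> / (1 - \<epsilon>) - s)) has_real_derivative
      ln (l / \<gamma>) + \<gamma> / (1 - \<epsilon>) / l - 1 / (1 - \<epsilon>)) (at \<gamma>)"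
    unfolding l_def
    by (rule poisson_exponent_shift_has_derivative) (use pos assms in \<open>auto simp: l_def\<close>)
  ultimately show "\<exists>d. ((\<lambda>\<gamma>. poisson_exponent \<gamma> (\<gamma> / (1 - \<epsilon>) - s)) has_real_derivative d) (at \<gamma>) \<and> d < 0"
    by blast
qed

lemma Q_shift_decreasing:
  assumes "0 < \<epsilon>" "\<epsilon> < 1" "0 < s" "s * (1 - \<epsilon>) / \<epsilon> \<le> a" "a < b"
  shows "Q_shift \<epsilon> s b < Q_shift \<epsilon> s a"
  unfolding Q_shift_def using poisson_exponent_shift_decreasing[OF assms] upper_rate_pos[of \<epsilon>] assms
  by (intro add_strict_mono) auto

text \<open>Existence is the intermediate value theorem between the left end of the range, where the
  value exceeds 1, and a point where the upper estimate has dropped below \<open>\<delta>\<close>.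
  Uniqueness is strict decrease.\<close>

lemma Q_shift_unique_solution:
  assumes "0 < \<epsilon>" "\<epsilon> < 1" "0 < s" "0 < \<delta>" "\<delta> < 1"
  shows "\<exists>!\<gamma>. s * (1 - \<epsilon>) / \<epsilon> < \<gamma> \<and> Q_shift \<epsilon> s \<gamma> = \<delta>"
proof -
  define a where "a = s * (1 - \<epsilon>) / \<epsilon>"
  have a: "0 < a" using assms by (simp add: a_def)
  have start: "1 < Q_shift \<epsilon> s a"
  proof -
    \<comment> \<open>At the threshold the mean equals \<open>a\<close>, so the Poisson exponent is
      0 and the second summand is 1.\<close>
    have "a / (1 - \<epsilon>) - s = a" using assms by (simp add: a_def field_simps)
    then show ?thesis using a by (simp add: Q_shift_def poisson_exponent_def)
  qed
  have "((\<lambda>\<gamma>. exp (- (\<gamma> * upper_rate \<epsilon>)) + exp (s * \<epsilon> - \<gamma> * lower_rate \<epsilon>)) \<longlongrightarrow> 0) at_top"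
  proof -
    have "((\<lambda>\<gamma>. exp (- (\<gamma> * c)) + exp (s * \<epsilon> - \<gamma> * d)) \<longlongrightarrow> 0) at_top"
      if "0 < c" "0 < d" for c d :: real
    proof (rule tendsto_add_zero)
      show "((\<lambda>\<gamma>. exp (- (\<gamma> * c))) \<longlongrightarrow> 0) at_top"
        using that by real_asymp
      show "((\<lambda>\<gamma>. exp (s * \<epsilon> - \<gamma> * d)) \<longlongrightarrow> 0) at_top"
        using that by real_asymp
    qed
    then show ?thesis
      using upper_rate_pos[OF assms(1)] lower_rate_pos[OF assms(1,2)] by blast
  qed
  then have "eventually (\<lambda>\<gamma>. exp (- (\<gamma> * upper_rate \<epsilon>)) + exp (s * \<epsilon> - \<gamma> * lower_rate \<epsilon>) < \<delta>) at_top"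
    using assms by (intro order_tendstoD(2)) auto
  then have "eventually (\<lambda>\<gamma>. exp (- (\<gamma> * upper_rate \<epsilon>)) + exp (s * \<epsilon> - \<gamma> * lower_rate \<epsilon>) < \<delta> \<and> a < \<gamma>) at_top"
    using eventually_gt_at_top by (rule eventually_conj)
  then obtain b where b: "a < b"
      "exp (- (b * upper_rate \<epsilon>)) + exp (s * \<epsilon> - b * lower_rate \<epsilon>) < \<delta>"
    by (auto simp: eventually_at_top_linorder)
  then have fin: "Q_shift \<epsilon> s b < \<delta>"
    using poisson_exponent_shift_bounds(2)[of \<epsilon> s b] assms
    by (simp add: Q_shift_def a_def) (smt (verit) exp_le_cancel_iff)
  have "continuous_on {a..b} (Q_shift \<epsilon> s)"
    unfolding Q_shift_def
    by (intro continuous_intros poisson_exponent_shift_continuous_on) (use assms in \<open>auto simp: a_def\<close>)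
  then obtain g where g: "a \<le> g" "Q_shift \<epsilon> s g = \<delta>"
    using IVT2'[of "Q_shift \<epsilon> s" b \<delta> a] start fin b assms by auto
  moreover have "g \<noteq> a" using g start assms by auto
  ultimately have "a < g \<and> Q_shift \<epsilon> s g = \<delta>" by auto
  moreover have "g' = g" if "a < g' \<and> Q_shift \<epsilon> s g' = \<delta>" for g'
    using that \<open>a < g \<and> _\<close> Q_shift_decreasing[OF assms(1-3), of g g']
      Q_shift_decreasing[OF assms(1-3), of g' g]
    unfolding a_def by (metis less_eq_real_def less_irrefl linorder_less_linear)
  ultimately show ?thesis unfolding a_def by blast
qed

lemma Q_tilde_eq_Q_shift:
  assumes "0 < \<epsilon>" "\<epsilon> < 1" "(1 - \<epsilon>) / \<epsilon> < \<gamma>"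
  shows "Q_tilde \<epsilon> \<gamma> = Q_shift \<epsilon> 1 \<gamma>"
proof (rule Q_tilde_eq)
  have "(1 - \<epsilon>) * 1 \<le> (1 - \<epsilon>) * (1 / \<epsilon>)"
    using assms by (intro mult_left_mono) auto
  then show "1 - \<epsilon> < \<gamma>" using assms by simp
qed (use assms in auto)

lemma Q_hat_eq_Q_shift:
  assumes "0 < \<epsilon>" "\<epsilon> < 1" "1 / \<epsilon> < \<gamma>"
  shows "Q_hat \<epsilon> \<gamma> = Q_shift \<epsilon> (1 / (1 - \<epsilon>)) \<gamma>"
proof (rule Q_hat_eq)
  have "1 < 1 / \<epsilon>" using assms by simp
  then show "1 < \<gamma>" using assms by linarith
qed (use assms in auto)

lemma hat_threshold:
  fixes \<epsilon> :: real
  assumes "\<epsilon> < 1"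
  shows "1 / (1 - \<epsilon>) * (1 - \<epsilon>) / \<epsilon> = 1 / \<epsilon>"
  using assms by simp

section \<open>Strict decrease and unique solvability for the two original error bounds\<close>

lemma Q_tilde_strict_antimono:
  assumes "0 < \<epsilon>" "\<epsilon> < 1"
  shows "strict_antimono_on {(1 - \<epsilon>) / \<epsilon> <..} (Q_tilde \<epsilon>)"
  using Q_shift_decreasing[of \<epsilon> 1] assms
  by (auto simp: Q_tilde_eq_Q_shift intro!: monotone_onI)

lemma Q_hat_strict_antimono:
  assumes "0 < \<epsilon>" "\<epsilon> < 1"
  shows "strict_antimono_on {1 / \<epsilon> <..} (Q_hat \<epsilon>)"
  using Q_shift_decreasing[of \<epsilon> "1 / (1 - \<epsilon>)"] assms hat_threshold[of \<epsilon>]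
  by (auto simp: Q_hat_eq_Q_shift intro!: monotone_onI)

lemma Q_tilde_unique_solution:
  assumes "0 < \<epsilon>" "\<epsilon> < 1" "0 < \<delta>" "\<delta> < 1"
  shows "\<exists>!\<gamma>. (1 - \<epsilon>) / \<epsilon> < \<gamma> \<and> Q_tilde \<epsilon> \<gamma> = \<delta>"
proof -
  have "(1 - \<epsilon>) / \<epsilon> < \<gamma> \<and> Q_tilde \<epsilon> \<gamma> = \<delta> \<longleftrightarrow> 1 * (1 - \<epsilon>) / \<epsilon> < \<gamma> \<and> Q_shift \<epsilon> 1 \<gamma> = \<delta>" for \<gamma>
    using Q_tilde_eq_Q_shift[of \<epsilon> \<gamma>] assms by auto
  then show ?thesis
    using Q_shift_unique_solution[of \<epsilon> 1 \<delta>] assms by simp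
qed

lemma Q_hat_unique_solution:
  assumes "0 < \<epsilon>" "\<epsilon> < 1" "0 < \<delta>" "\<delta> < 1"
  shows "\<exists>!\<gamma>. 1 / \<epsilon> < \<gamma> \<and> Q_hat \<epsilon> \<gamma> = \<delta>"
proof -
  have "1 / \<epsilon> < \<gamma> \<and> Q_hat \<epsilon> \<gamma> = \<delta> \<longleftrightarrow>
      1 / (1 - \<epsilon>) * (1 - \<epsilon>) / \<epsilon> < \<gamma> \<and> Q_shift \<epsilon> (1 / (1 - \<epsilon>)) \<gamma> = \<delta>" for \<gamma>
    unfolding hat_threshold[OF assms(2)] using Q_hat_eq_Q_shift[of \<epsilon> \<gamma>] assms by auto
  then show ?thesis
    using Q_shift_unique_solution[of \<epsilon> "1 / (1 - \<epsilon>)" \<delta>] assms by simp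
qed

section \<open>The solutions of the error equations\<close>

text \<open>Locates a solution of an error equation relative to a trial point by comparing values
  only.\<close>

lemma strict_antimono_on_less_imp_less:
  fixes f :: "'a :: linorder \<Rightarrow> 'b :: order"
  assumes "strict_antimono_on A f" "x \<in> A" "y \<in> A" "f y < f x"
  shows "x < y"
  using monotone_onD[OF assms(1) assms(3,2)] assms(4) by (cases x y rule: linorder_cases) auto

section \<open>Comparison of the solutions with each other and with explicit bounds\<close>

context
  fixes \<epsilon> \<delta> :: real
  assumes \<epsilon>: "0 < \<epsilon>" "\<epsilon> < 1" and \<delta>: "0 < \<delta>" "\<delta> < 1"
begin

lemma gamma_tilde:
  shows "(1 - \<epsilon>) / \<epsilon> < gamma_tilde \<epsilon> \<delta>" and "Q_tilde \<epsilon> (gamma_tilde \<epsilon> \<delta>) = \<delta>"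
  using theI'[OF Q_tilde_unique_solution[OF \<epsilon> \<delta>]] by (auto simp: gamma_tilde_def)

lemma gamma_hat:
  shows "1 / \<epsilon> < gamma_hat \<epsilon> \<delta>" and "Q_hat \<epsilon> (gamma_hat \<epsilon> \<delta>) = \<delta>"
  using theI'[OF Q_hat_unique_solution[OF \<epsilon> \<delta>]] by (auto simp: gamma_hat_def)

lemma gamma_tilde_less:
  assumes "(1 - \<epsilon>) / \<epsilon> < g" "Q_tilde \<epsilon> g < \<delta>"
  shows "gamma_tilde \<epsilon> \<delta> < g"
  by (rule strict_antimono_on_less_imp_less[OF Q_tilde_strict_antimono[OF \<epsilon>]])
    (use assms gamma_tilde in simp_all)

lemma gamma_hat_less:
  assumes "1 / \<epsilon> < g" "Q_hat \<epsilon> g < \<delta>"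
  shows "gamma_hat \<epsilon> \<delta> < g"
  by (rule strict_antimono_on_less_imp_less[OF Q_hat_strict_antimono[OF \<epsilon>]])
    (use assms gamma_hat in simp_all)

text \<open>\<open>Q_hat\<close> has the larger shift, since
  \<open>1 < 1 / (1 - \<epsilon>)\<close>, hence the smaller Poisson mean and the larger second
  summand. So \<open>Q_tilde\<close> is already below \<open>\<delta>\<close> at
  \<open>gamma_hat\<close>.\<close>

lemma gamma_tilde_less_gamma_hat: "gamma_tilde \<epsilon> \<delta> < gamma_hat \<epsilon> \<delta>"
proof (rule gamma_tilde_less)
  let ?g = "gamma_hat \<epsilon> \<delta>"
  have "(1 - \<epsilon>) / \<epsilon> < 1 / \<epsilon>" using \<epsilon> by (simp add: divide_strict_right_mono)
  then show g: "(1 - \<epsilon>) / \<epsilon> < ?g" using gamma_hat(1) by linarith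
  have "0 < 1 / \<epsilon>" using \<epsilon> by simp
  then have "0 < ?g" using gamma_hat(1) by linarith
  moreover have "?g \<le> ?g / (1 - \<epsilon>) - 1 / (1 - \<epsilon>)"
    using threshold_less_iff(1)[of \<epsilon> "1 / (1 - \<epsilon>)" ?g] \<epsilon> gamma_hat(1)
    unfolding hat_threshold[OF \<epsilon>(2)] by simp
  moreover have "?g / (1 - \<epsilon>) - 1 / (1 - \<epsilon>) < ?g / (1 - \<epsilon>) - 1"
    using \<epsilon> by simp
  ultimately have "Q_shift \<epsilon> 1 ?g < Q_shift \<epsilon> (1 / (1 - \<epsilon>)) ?g"
    unfolding Q_shift_def using poisson_exponent_decreasing by simp
  then show "Q_tilde \<epsilon> ?g < \<delta>"
    using Q_tilde_eq_Q_shift[OF \<epsilon> g] Q_hat_eq_Q_shift[OF \<epsilon> gamma_hat(1)] gamma_hat(2) by simp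
qed

text \<open>At \<open>h = g / (1 - \<epsilon>)\<close> the Poisson mean in \<open>Q_hat\<close> is that of \<open>Q_tilde\<close> at \<open>g\<close>, also divided by
  \<open>1 - \<epsilon>\<close>, so the negative exponent gets scaled up.\<close>

lemma gamma_hat_less_gamma_tilde: "(1 - \<epsilon>) * gamma_hat \<epsilon> \<delta> < gamma_tilde \<epsilon> \<delta>"
proof -
  define g where "g = gamma_tilde \<epsilon> \<delta>"
  define h where "h = g / (1 - \<epsilon>)"
  define l where "l = g / (1 - \<epsilon>) - 1"
  have "0 < (1 - \<epsilon>) / \<epsilon>" using \<epsilon> by simp
  then have g: "0 < g" "(1 - \<epsilon>) / \<epsilon> < g"
    using gamma_tilde(1) by (auto simp: g_def)
  have h: "1 / \<epsilon> < h" "g < h"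
    using g \<epsilon> by (auto simp: h_def field_simps)
  have "g < l"
    using threshold_less_iff(1)[of \<epsilon> 1 g] \<epsilon> g by (simp add: l_def)
  then have neg: "poisson_exponent g l < 0"
    using g by (intro poisson_exponent_neg)
  have "poisson_exponent h (h / (1 - \<epsilon>) - 1 / (1 - \<epsilon>)) = poisson_exponent g l / (1 - \<epsilon>)"
  proof -
    have "h / (1 - \<epsilon>) - 1 / (1 - \<epsilon>) = l / (1 - \<epsilon>)"
      by (simp add: h_def l_def diff_divide_distrib)
    then show ?thesis
      using \<epsilon> by (simp add: poisson_exponent_def h_def diff_divide_distrib add_divide_distrib)
  qed
  also have "\<dots> < poisson_exponent g l"
    using neg \<epsilon> by (simp add: divide_less_eq right_diff_distrib mult_pos_neg mult_neg_pos)
  finally have "Q_shift \<epsilon> (1 / (1 - \<epsilon>)) h < Q_shift \<epsilon> 1 g"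
    unfolding Q_shift_def l_def using h upper_rate_pos[OF \<epsilon>(1)]
    by (intro add_strict_mono) auto
  then have "Q_hat \<epsilon> h < \<delta>"
    using Q_tilde_eq_Q_shift[OF \<epsilon> g(2)] Q_hat_eq_Q_shift[OF \<epsilon> h(1)] gamma_tilde(2) by (simp add: g_def)
  then have "gamma_hat \<epsilon> \<delta> < h"
    using h by (intro gamma_hat_less)
  then show ?thesis
    using \<epsilon> by (simp add: h_def g_def field_simps)
qed

lemma ln_two_div_greater: "1 / 2 < ln (2 / \<delta>)"
proof -
  have "ln 2 < ln (2 / \<delta>)" using \<delta> by (simp add: less_divide_eq)
  then show ?thesis using ln_2_greater by simp
qed

text \<open>At the bound \<open>K\<close> the first summand is exactly \<open>\<delta> / 2\<close>.
  The second is smaller because \<open>K\<close> times the gap between the rates outweighs the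
  excess \<open>\<epsilon> / (1 - \<epsilon>)\<close>.\<close>

lemma gamma_hat_less_bound: "gamma_hat \<epsilon> \<delta> < ln (2 / \<delta>) / upper_rate \<epsilon>"
proof (rule gamma_hat_less)
  define K where "K = ln (2 / \<delta>) / upper_rate \<epsilon>"
  have c: "0 < upper_rate \<epsilon>" using \<epsilon> by (intro upper_rate_pos)
  \<comment> \<open>The factor \<open>1 / 2\<close> bounds \<open>ln (2 / \<delta>)\<close> from
    below and cancels the 2 in \<open>upper_rate_less\<close>.\<close>
  have "(1 / 2) / (\<epsilon>\<^sup>2 / (2 * (1 + \<epsilon>))) < K"
    unfolding K_def using ln_two_div_greater upper_rate_less[OF \<epsilon>(1)] c by (intro frac_less) auto
  then have K: "(1 + \<epsilon>) / \<epsilon>\<^sup>2 < K"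
    using \<epsilon> by (simp add: field_simps)
  have "1 / \<epsilon> < (1 + \<epsilon>) / \<epsilon>\<^sup>2"
    using \<epsilon> by (simp add: field_simps power2_eq_square)
  with K show K1: "1 / \<epsilon> < ln (2 / \<delta>) / upper_rate \<epsilon>" unfolding K_def by linarith
  have sq: "\<epsilon>\<^sup>2 < 1" using \<epsilon> by (simp add: power_less_one_iff)
  have "\<epsilon> / (1 - \<epsilon>) = ((1 + \<epsilon>) / \<epsilon>\<^sup>2) * (\<epsilon> ^ 3 / (1 - \<epsilon>\<^sup>2))"
  proof -
    have "1 - \<epsilon>\<^sup>2 = (1 - \<epsilon>) * (1 + \<epsilon>)" by (simp add: algebra_simps power2_eq_square)
    then show ?thesis using \<epsilon> by (simp add: power2_eq_square power3_eq_cube)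
  qed
  also have "\<dots> < K * (lower_rate \<epsilon> - upper_rate \<epsilon>)"
    using K rate_gap[OF \<epsilon>] \<epsilon> sq by (intro mult_strict_mono) (auto simp: zero_less_mult_iff intro: less_trans[rotated])
  finally have "1 / (1 - \<epsilon>) * \<epsilon> - K * lower_rate \<epsilon> < - (K * upper_rate \<epsilon>)"
    by (simp add: right_diff_distrib)
  moreover have "poisson_exponent K (K / (1 - \<epsilon>) - 1 / (1 - \<epsilon>)) < 1 / (1 - \<epsilon>) * \<epsilon> - K * lower_rate \<epsilon>"
    using \<epsilon> K1 hat_threshold[OF \<epsilon>(2)]
    by (intro poisson_exponent_shift_bounds) (auto simp: K_def)
  ultimately have "Q_shift \<epsilon> (1 / (1 - \<epsilon>)) K < 2 * exp (- (K * upper_rate \<epsilon>))"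
    by (simp add: Q_shift_def)
  also have "K * upper_rate \<epsilon> = ln (2 / \<delta>)"
    using c by (simp add: K_def)
  also have "2 * exp (- ln (2 / \<delta>)) = \<delta>"
    using \<delta> by (simp add: exp_minus)
  finally show "Q_hat \<epsilon> (ln (2 / \<delta>) / upper_rate \<epsilon>) < \<delta>"
    using Q_hat_eq_Q_shift[OF \<epsilon> K1] by (simp add: K_def)
qed

text \<open>The first summand alone is below \<open>\<delta>\<close>, because the second is
  positive.\<close>

lemma gamma_tilde_greater: "ln (1 / \<delta>) < gamma_tilde \<epsilon> \<delta> * upper_rate \<epsilon>"
proof -
  have "exp (- (gamma_tilde \<epsilon> \<delta> * upper_rate \<epsilon>)) < \<delta>"
    using gamma_tilde(2)[unfolded Q_tilde_eq_Q_shift[OF \<epsilon> gamma_tilde(1)] Q_shift_def]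
    by (smt (verit) exp_gt_zero)
  then have "- (gamma_tilde \<epsilon> \<delta> * upper_rate \<epsilon>) < ln \<delta>"
    using \<delta> ln_less_cancel_iff[of "exp (- (gamma_tilde \<epsilon> \<delta> * upper_rate \<epsilon>))" \<delta>] by simp
  then show ?thesis using \<delta> by (simp add: ln_div)
qed

text \<open>Both summands are at least \<open>exp (- (g * lower_rate \<epsilon>))\<close>: the first
  since \<open>upper_rate\<close> is the smaller rate, the second by the lower estimate of its
  exponent. Together they sum to \<open>\<delta>\<close>.\<close>

lemma gamma_tilde_ge: "ln (2 / \<delta>) \<le> gamma_tilde \<epsilon> \<delta> * lower_rate \<epsilon>"
proof -
  define g where "g = gamma_tilde \<epsilon> \<delta>"
  have "0 < (1 - \<epsilon>) / \<epsilon>" using \<epsilon> by simp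
  then have g: "0 < g" "(1 - \<epsilon>) / \<epsilon> < g"
    using gamma_tilde(1) by (auto simp: g_def)
  have sq: "\<epsilon>\<^sup>2 < 1" using \<epsilon> by (simp add: power_less_one_iff)
  then have "0 < \<epsilon> ^ 3 / (1 - \<epsilon>\<^sup>2)" using \<epsilon> by simp
  then have "upper_rate \<epsilon> \<le> lower_rate \<epsilon>" using rate_gap[OF \<epsilon>] by linarith
  then have "exp (- (g * lower_rate \<epsilon>)) \<le> exp (- (g * upper_rate \<epsilon>))"
    using g by simp
  moreover have "exp (- (g * lower_rate \<epsilon>)) \<le> exp (poisson_exponent g (g / (1 - \<epsilon>) - 1))"
    using poisson_exponent_shift_bounds(1)[of \<epsilon> 1 g] \<epsilon> g by simp
  ultimately have "2 * exp (- (g * lower_rate \<epsilon>)) \<le> \<delta>"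
    using gamma_tilde(2)[unfolded Q_tilde_eq_Q_shift[OF \<epsilon> gamma_tilde(1)] Q_shift_def] unfolding g_def
    by linarith
  then have "exp (- (g * lower_rate \<epsilon>)) \<le> \<delta> / 2" by simp
  then have "- (g * lower_rate \<epsilon>) \<le> ln (\<delta> / 2)"
    using \<delta> ln_le_cancel_iff[of "exp (- (g * lower_rate \<epsilon>))" "\<delta> / 2"] by simp
  then show ?thesis using \<delta> by (simp add: ln_div g_def)
qed

end

text \<open>The quotient \<open>((1 + x) * ln (1 + x) - x) / x\<^sup>2\<close> is strictly
  decreasing and equals \<open>2 * ln 2 - 1\<close> at 1.\<close>

lemma one_plus_times_ln_greater:
  fixes \<epsilon> :: real
  assumes "0 < \<epsilon>" "\<epsilon> < 1"
  shows "(2 * ln 2 - 1) * \<epsilon>\<^sup>2 < (1 + \<epsilon>) * ln (1 + \<epsilon>) - \<epsilon>"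
proof -
  let ?f = "\<lambda>x::real. ((1 + x) * ln (1 + x) - x) / x\<^sup>2"
  have "?f 1 < ?f \<epsilon>"
  proof (rule DERIV_neg_imp_decreasing[OF assms(2)])
    fix y :: real
    assume y: "\<epsilon> \<le> y"
    define L where "L = ln (1 + y)"
    have "(?f has_real_derivative ((2 * y - (2 + y) * L) * y) / (y\<^sup>2 * y\<^sup>2)) (at y)"
      unfolding L_def using y assms
      by (auto intro!: derivative_eq_intros) (simp add: algebra_simps power2_eq_square)
    moreover have "2 * y < (2 + y) * L"
      using ln_one_plus_greater_Pade[of y] y assms by (simp add: L_def field_simps)
    then have "((2 * y - (2 + y) * L) * y) / (y\<^sup>2 * y\<^sup>2) < 0"
      using y assms by (intro divide_neg_pos mult_neg_pos) auto
    ultimately show "\<exists>d. (?f has_real_derivative d) (at y) \<and> d < 0"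
      by blast
  qed
  then show ?thesis
    using assms by (simp add: field_simps)
qed

lemma sample_size_bounds:
  fixes \<epsilon> L :: real
  assumes "0 < \<epsilon>" "\<epsilon> < 1" "0 < L"
  shows "(1 + \<epsilon>) * L / ((1 + \<epsilon>) * ln (1 + \<epsilon>) - \<epsilon>) < (1 + \<epsilon>) * L / ((2 * ln 2 - 1) * \<epsilon>\<^sup>2)"
    and "(1 + \<epsilon>) * L / ((2 * ln 2 - 1) * \<epsilon>\<^sup>2) < 4 * (exp 1 - 2) * (1 + \<epsilon>) * L / \<epsilon>\<^sup>2"
proof -
  have k: "13 / 35 < 2 * ln 2 - (1 :: real)" using ln_2_greater by simp
  then have "0 < (2 * ln 2 - 1) * \<epsilon>\<^sup>2" using assms by simp
  then have pos: "0 < (2 * ln 2 - 1) * \<epsilon>\<^sup>2" "0 < (1 + \<epsilon>) * ln (1 + \<epsilon>) - \<epsilon>"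
    using one_plus_times_ln_greater[OF assms(1,2)] by linarith+
  show "(1 + \<epsilon>) * L / ((1 + \<epsilon>) * ln (1 + \<epsilon>) - \<epsilon>) < (1 + \<epsilon>) * L / ((2 * ln 2 - 1) * \<epsilon>\<^sup>2)"
    using one_plus_times_ln_greater[OF assms(1,2)] pos k assms
    by (intro divide_strict_left_mono mult_pos_pos) auto
  \<comment> \<open>The constants come from \<open>2 * (24 / 35) - 1\<close> and
    \<open>268 / 100 - 2\<close>; the product exceeds 1 by about one percent.\<close>
  have "1 < (13 / 35) * (4 * (68 / 100 :: real))" by simp
  also have "\<dots> < (2 * ln 2 - 1) * (4 * (exp 1 - 2))"
    using k exp_1_greater by (intro mult_strict_mono[OF k]) auto
  finally have "1 / (2 * ln 2 - 1) < (4 * (exp 1 - 2) :: real)"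
    using k by (simp add: field_simps)
  then have "1 / (2 * ln 2 - 1) * ((1 + \<epsilon>) * L / \<epsilon>\<^sup>2) < 4 * (exp 1 - 2) * ((1 + \<epsilon>) * L / \<epsilon>\<^sup>2)"
    using assms by (intro mult_strict_right_mono) auto
  then show "(1 + \<epsilon>) * L / ((2 * ln 2 - 1) * \<epsilon>\<^sup>2) < 4 * (exp 1 - 2) * (1 + \<epsilon>) * L / \<epsilon>\<^sup>2"
    by (simp add: mult.assoc)
qed

lemma upper_rate_quotient:
  assumes "0 < \<epsilon>"
  shows "(1 + \<epsilon>) * L / ((1 + \<epsilon>) * ln (1 + \<epsilon>) - \<epsilon>) = L / upper_rate \<epsilon>"
proof -
  have "(1 + \<epsilon>) * ln (1 + \<epsilon>) - \<epsilon> = (1 + \<epsilon>) * upper_rate \<epsilon>"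
    using assms by (simp add: upper_rate_def right_diff_distrib)
  then show ?thesis using assms by simp
qed

text \<open>Each lower bound serves one limit: the first tends to 1 as \<open>\<delta>\<close> tends
  to 0, the second as \<open>\<epsilon>\<close> tends to 0.\<close>

lemma gamma_tilde_ratio_bounds:
  assumes "0 < \<epsilon>" "\<epsilon> < 1" "0 < \<delta>" "\<delta> < 1"
  defines "r \<equiv> gamma_tilde \<epsilon> \<delta> / (inverse (upper_rate \<epsilon>) * ln (2 / \<delta>))"
  shows "r \<le> 1" and "ln (1 / \<delta>) / ln (2 / \<delta>) \<le> r" and "upper_rate \<epsilon> / lower_rate \<epsilon> \<le> r"
proof -
  note c = upper_rate_pos[OF assms(1)] and d = lower_rate_pos[OF assms(1,2)]
  have L: "0 < ln (2 / \<delta>)" using ln_two_div_greater[OF assms(1-4)] by linarith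
  have r: "r = gamma_tilde \<epsilon> \<delta> * upper_rate \<epsilon> / ln (2 / \<delta>)"
    using c by (simp add: r_def field_simps)
  have "gamma_tilde \<epsilon> \<delta> < ln (2 / \<delta>) / upper_rate \<epsilon>"
    using gamma_tilde_less_gamma_hat[OF assms(1-4)] gamma_hat_less_bound[OF assms(1-4)] by linarith
  then show "r \<le> 1" using c L by (simp add: r field_simps)
  show "ln (1 / \<delta>) / ln (2 / \<delta>) \<le> r"
    unfolding r using gamma_tilde_greater[OF assms(1-4)] L by (intro divide_right_mono) auto
  have "upper_rate \<epsilon> * ln (2 / \<delta>) \<le> upper_rate \<epsilon> * (gamma_tilde \<epsilon> \<delta> * lower_rate \<epsilon>)"
    using gamma_tilde_ge[OF assms(1-4)] c by (intro mult_left_mono) auto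
  then show "upper_rate \<epsilon> / lower_rate \<epsilon> \<le> r"
    using c d L by (simp add: r field_simps)
qed

lemma gamma_tilde_limit_delta:
  assumes "0 < \<epsilon>" "\<epsilon> < 1"
  shows "((\<lambda>\<delta>. gamma_tilde \<epsilon> \<delta> / (inverse (upper_rate \<epsilon>) * ln (2 / \<delta>))) \<longlongrightarrow> 1) (at_right 0)"
proof (rule tendsto_sandwich)
  have ev: "eventually (\<lambda>\<delta>::real. 0 < \<delta> \<and> \<delta> < 1) (at_right 0)"
    by (auto simp: eventually_at_right[of 0 1] intro: exI[of _ 1])
  show "eventually (\<lambda>\<delta>. ln (1 / \<delta>) / ln (2 / \<delta>) \<le>
      gamma_tilde \<epsilon> \<delta> / (inverse (upper_rate \<epsilon>) * ln (2 / \<delta>))) (at_right 0)"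
    using ev by eventually_elim (use gamma_tilde_ratio_bounds assms in blast)
  show "eventually (\<lambda>\<delta>. gamma_tilde \<epsilon> \<delta> / (inverse (upper_rate \<epsilon>) * ln (2 / \<delta>)) \<le> 1) (at_right 0)"
    using ev by eventually_elim (use gamma_tilde_ratio_bounds assms in blast)
  show "((\<lambda>\<delta>::real. ln (1 / \<delta>) / ln (2 / \<delta>)) \<longlongrightarrow> 1) (at_right 0)"
    by real_asymp
qed simp

lemma gamma_tilde_limit_epsilon:
  assumes "0 < \<delta>" "\<delta> < 1"
  shows "((\<lambda>\<epsilon>. gamma_tilde \<epsilon> \<delta> / (inverse (upper_rate \<epsilon>) * ln (2 / \<delta>))) \<longlongrightarrow> 1) (at_right 0)"
proof (rule tendsto_sandwich)
  have ev: "eventually (\<lambda>\<epsilon>::real. 0 < \<epsilon> \<and> \<epsilon> < 1) (at_right 0)"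
    by (auto simp: eventually_at_right[of 0 1] intro: exI[of _ 1])
  show "eventually (\<lambda>\<epsilon>. upper_rate \<epsilon> / lower_rate \<epsilon> \<le>
      gamma_tilde \<epsilon> \<delta> / (inverse (upper_rate \<epsilon>) * ln (2 / \<delta>))) (at_right 0)"
    using ev by eventually_elim (use gamma_tilde_ratio_bounds assms in blast)
  show "eventually (\<lambda>\<epsilon>. gamma_tilde \<epsilon> \<delta> / (inverse (upper_rate \<epsilon>) * ln (2 / \<delta>)) \<le> 1) (at_right 0)"
    using ev by eventually_elim (use gamma_tilde_ratio_bounds assms in blast)
  \<comment> \<open>Both rates are \<open>\<epsilon>\<^sup>2 / 2\<close> to leading order.\<close>
  show "((\<lambda>\<epsilon>. upper_rate \<epsilon> / lower_rate \<epsilon>) \<longlongrightarrow> 1) (at_right 0)"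
    unfolding upper_rate_def lower_rate_def by real_asymp
qed simp

section \<open>Tail bounds for the sample size\<close>

text \<open>This \<open>t\<close> solves \<open>a * exp t = 1 - \<mu> + \<mu> * exp t\<close>, the
  stationarity condition of the left side. It is negative for \<open>a > 1\<close> and positive for
  \<open>a < 1\<close>, so both tails are covered.\<close>

lemma chernoff_optimum:
  fixes a \<mu> \<gamma> :: real
  assumes "0 < \<mu>" "\<mu> < 1" "\<mu> < a"
  defines "t \<equiv> ln ((1 - \<mu>) / (a - \<mu>))"
  shows "exp (- (t * \<gamma>)) * (1 - \<mu> + \<mu> * exp t) powr (a * (\<gamma> / \<mu>))
    = a powr (a * (\<gamma> / \<mu>)) * ((1 - \<mu>) / (a - \<mu>)) powr ((a - \<mu>) * (\<gamma> / \<mu>))"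
proof -
  define r where "r = (1 - \<mu>) / (a - \<mu>)"
  have r: "0 < r" using assms by (simp add: r_def)
  have "(1 - \<mu>) = r * (a - \<mu>)" using assms by (simp add: r_def)
  then have base: "1 - \<mu> + \<mu> * exp t = a * r"
    using r by (simp add: t_def r_def[symmetric] algebra_simps)
  have "exp (- (t * \<gamma>)) = r powr (- \<gamma>)"
    using r by (simp add: t_def r_def[symmetric] powr_def)
  moreover have "- \<gamma> + a * (\<gamma> / \<mu>) = (a - \<mu>) * (\<gamma> / \<mu>)"
    using assms by (simp add: field_simps)
  ultimately show ?thesis
    unfolding base using r assms
    by (simp add: powr_mult r_def[symmetric] flip: powr_add)
qed

text \<open>By \<open>1 + z \<le> exp z\<close>. Afterwards \<open>\<mu>\<close> enters only through
  the mean \<open>y * \<mu>\<close>, which the estimators control.\<close>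

lemma chernoff_le_poisson:
  fixes \<mu> t y :: real
  assumes "0 \<le> \<mu>" "\<mu> \<le> 1" "0 \<le> y"
  shows "exp (- (t * \<gamma>)) * (1 - \<mu> + \<mu> * exp t) powr y \<le> exp (y * \<mu> * (exp t - 1) - t * \<gamma>)"
proof -
  have "0 \<le> 1 - \<mu> + \<mu> * exp t" using assms by simp
  moreover have "1 - \<mu> + \<mu> * exp t \<le> exp (\<mu> * (exp t - 1))"
    using exp_ge_add_one_self[of "\<mu> * (exp t - 1)"] by (simp add: algebra_simps)
  ultimately have "(1 - \<mu> + \<mu> * exp t) powr y \<le> exp (\<mu> * (exp t - 1)) powr y"
    using assms by (intro powr_mono2)
  also have "\<dots> = exp (y * \<mu> * (exp t - 1))"
    by (simp add: powr_def algebra_simps)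
  finally have "exp (- (t * \<gamma>)) * (1 - \<mu> + \<mu> * exp t) powr y \<le> exp (- (t * \<gamma>)) * exp (y * \<mu> * (exp t - 1))"
    by (intro mult_left_mono) auto
  then show ?thesis by (simp add: exp_add[symmetric] add.commute)
qed

text \<open>A finite infimum means a nonempty set, and a nonempty set of extended naturals attains
  its infimum.\<close>

lemma sum_ge_if_sample_size_eq:
  assumes "sample_size \<gamma> X \<omega> = enat n"
  shows "\<gamma> \<le> (\<Sum>i=1..n. X i \<omega>)"
proof -
  let ?A = "{enat n | n. (\<Sum>i=1..n. X i \<omega>) \<ge> \<gamma>}"
  have "?A \<noteq> {}"
    using assms unfolding sample_size_def Inf_enat_def by (auto split: if_splits)
  then have "Inf ?A \<in> ?A"
    unfolding Inf_enat_def by (simp only: if_False) (rule LeastI_ex, blast)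
  then show ?thesis using assms by (auto simp: sample_size_def)
qed

lemma sum_less_if_less_sample_size:
  assumes "enat k < sample_size \<gamma> X \<omega>"
  shows "(\<Sum>i=1..k. X i \<omega>) < \<gamma>"
proof (rule ccontr)
  assume "\<not> (\<Sum>i=1..k. X i \<omega>) < \<gamma>"
  then have "sample_size \<gamma> X \<omega> \<le> enat k"
    unfolding sample_size_def by (intro Inf_lower) auto
  with assms show False by simp
qed

section \<open>Chernoff bounds for the partial sums and the sample size\<close>

locale bounded_sampling = prob_space M for M :: "'a measure" +
  fixes X :: "nat \<Rightarrow> 'a \<Rightarrow> real" and \<mu> \<gamma> :: real
  assumes indep: "indep_vars (\<lambda>_. borel) X {1..}"
    and bounded: "i \<ge> 1 \<Longrightarrow> AE \<omega> in M. 0 \<le> X i \<omega> \<and> X i \<omega> \<le> 1"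
    and mean: "i \<ge> 1 \<Longrightarrow> expectation (X i) = \<mu>"
    and mu: "0 < \<mu>" "\<mu> < 1"
    and gamma: "1 < \<gamma>"
begin

lemma random_variable_X: "i \<ge> 1 \<Longrightarrow> random_variable borel (X i)"
  using indep by (auto simp: indep_vars_def)

lemma AE_bounded: "AE \<omega> in M. \<forall>i\<ge>1. 0 \<le> X i \<omega> \<and> X i \<omega> \<le> 1"
proof -
  have "AE \<omega> in M. i \<ge> 1 \<longrightarrow> 0 \<le> X i \<omega> \<and> X i \<omega> \<le> 1" for i
    using bounded by (cases "i \<ge> 1") auto
  then show ?thesis by (simp add: AE_all_countable)
qed

lemma
  assumes "i \<ge> 1"
  shows integrable_exp_X: "integrable M (\<lambda>\<omega>. exp (t * X i \<omega>))"
    and expectation_exp_X_le: "expectation (\<lambda>\<omega>. exp (t * X i \<omega>)) \<le> 1 - \<mu> + \<mu> * exp t"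
proof -
  note [measurable] = random_variable_X[OF assms]
  \<comment> \<open>The chord over \<open>[0, 1]\<close> is affine in \<open>x\<close>, so its
    expectation is determined by the mean.\<close>
  have chord: "exp (t * x) \<le> (1 - x) + x * exp t" if "0 \<le> x" "x \<le> 1" for x
    using convex_onD[OF exp_convex, of x 0 t] that by (simp add: mult.commute)
  have int: "integrable M (X i)"
    by (rule integrable_const_bound[where B = 1]) (use bounded[OF assms] in auto)
  then have int': "integrable M (\<lambda>\<omega>. (1 - X i \<omega>) + X i \<omega> * exp t)"
    by simp
  have "AE \<omega> in M. norm (exp (t * X i \<omega>)) \<le> norm ((1 - X i \<omega>) + X i \<omega> * exp t)"
    using bounded[OF assms]
  proof eventually_elim
    case (elim \<omega>)
    then show ?case using chord[of "X i \<omega>"] by simp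
  qed
  then show int_exp: "integrable M (\<lambda>\<omega>. exp (t * X i \<omega>))"
    by (intro Bochner_Integration.integrable_bound[OF int']) auto
  have "expectation (\<lambda>\<omega>. exp (t * X i \<omega>)) \<le> expectation (\<lambda>\<omega>. (1 - X i \<omega>) + X i \<omega> * exp t)"
    using bounded[OF assms] chord by (intro integral_mono_AE int_exp int') auto
  also have "\<dots> = 1 - \<mu> + \<mu> * exp t"
    using int mean[OF assms] by (simp add: prob_space)
  finally show "expectation (\<lambda>\<omega>. exp (t * X i \<omega>)) \<le> 1 - \<mu> + \<mu> * exp t" .
qed

text \<open>Markov's inequality for the product of the independent exponentials. Keeping the factor
  \<open>t\<close> in the event handles both tails: \<open>t > 0\<close> means a sum at least
  \<open>\<gamma>\<close>, \<open>t < 0\<close> a sum at most \<open>\<gamma>\<close>.\<close>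

lemma chernoff_bound:
  shows "{\<omega> \<in> space M. t * \<gamma> \<le> t * (\<Sum>i=1..k. X i \<omega>)} \<in> events"
    and "prob {\<omega> \<in> space M. t * \<gamma> \<le> t * (\<Sum>i=1..k. X i \<omega>)}
      \<le> exp (- (t * \<gamma>)) * (1 - \<mu> + \<mu> * exp t) ^ k"
proof -
  have [measurable]: "random_variable borel (X i)" if "i \<in> {1..k}" for i
    using that by (intro random_variable_X) auto
  show "{\<omega> \<in> space M. t * \<gamma> \<le> t * (\<Sum>i=1..k. X i \<omega>)} \<in> events"
    by measurable
  let ?Y = "\<lambda>i \<omega>. exp (t * X i \<omega>)"
  have indep_Y: "indep_vars (\<lambda>_. borel) ?Y {1..k}"
    by (rule indep_vars_compose2[where Y = "\<lambda>_ x. exp (t * x)" and M' = "\<lambda>_. borel"])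
      (auto intro: indep_vars_subset[OF indep])
  have int_Y: "integrable M (?Y i)" if "i \<in> {1..k}" for i
    using that by (intro integrable_exp_X) auto
  have int: "integrable M (\<lambda>\<omega>. \<Prod>i=1..k. ?Y i \<omega>)"
    by (rule indep_vars_integrable) (use indep_Y int_Y in auto)
  have "expectation (\<lambda>\<omega>. \<Prod>i=1..k. ?Y i \<omega>) = (\<Prod>i=1..k. expectation (?Y i))"
    by (rule indep_vars_lebesgue_integral) (use indep_Y int_Y in auto)
  also have "\<dots> \<le> (\<Prod>i=1..k. 1 - \<mu> + \<mu> * exp t)"
    using expectation_exp_X_le by (intro prod_mono) (auto intro: Bochner_Integration.integral_nonneg)
  finally have "expectation (\<lambda>\<omega>. \<Prod>i=1..k. ?Y i \<omega>) \<le> (1 - \<mu> + \<mu> * exp t) ^ k"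
    by simp
  moreover have "prob {\<omega> \<in> space M. exp (t * \<gamma>) \<le> (\<Prod>i=1..k. ?Y i \<omega>)}
      \<le> expectation (\<lambda>\<omega>. \<Prod>i=1..k. ?Y i \<omega>) / exp (t * \<gamma>)"
    by (rule integral_Markov_inequality_measure[OF int sets.empty_sets])
      (auto intro!: AE_I2 prod_nonneg)
  moreover have "exp (t * \<gamma>) \<le> (\<Prod>i=1..k. ?Y i \<omega>) \<longleftrightarrow> t * \<gamma> \<le> t * (\<Sum>i=1..k. X i \<omega>)" for \<omega>
    by (simp add: exp_sum[symmetric] sum_distrib_left)
  ultimately show "prob {\<omega> \<in> space M. t * \<gamma> \<le> t * (\<Sum>i=1..k. X i \<omega>)}
      \<le> exp (- (t * \<gamma>)) * (1 - \<mu> + \<mu> * exp t) ^ k"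
    by (simp add: exp_minus field_simps)
qed

text \<open>The events are covered by measurable sets, so that the measurability of \<open>sample_size\<close> is never
  needed.\<close>

lemma late_stopping_event:
  assumes "t \<le> 0" "1 \<le> x"
  obtains E where "E \<in> events"
    "prob E \<le> exp (- (t * \<gamma>)) * (1 - \<mu> + \<mu> * exp t) powr (x - 1)"
    "\<And>\<omega>. \<omega> \<in> space M \<Longrightarrow> ereal x \<le> ereal_of_enat (sample_size \<gamma> X \<omega>) \<Longrightarrow> \<omega> \<in> E"
proof
  \<comment> \<open>The largest integer strictly below \<open>x\<close>: stopping at
    \<open>x\<close> or later, or never, leaves the sum of the first \<open>k\<close> samples below
    \<open>\<gamma>\<close>. Only \<open>k \<ge> x - 1\<close> is guaranteed, hence the loss of one
    sample in the exponent.\<close>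
  define k where "k = nat (\<lceil>x\<rceil> - 1)"
  have k: "x - 1 \<le> real k" "real k < x"
    using assms(2) unfolding k_def by linarith+
  let ?E = "{\<omega> \<in> space M. t * \<gamma> \<le> t * (\<Sum>i=1..k. X i \<omega>)}"
  show "?E \<in> events" by (rule chernoff_bound)
  have b: "0 < 1 - \<mu> + \<mu> * exp t" "1 - \<mu> + \<mu> * exp t \<le> 1"
    using mu assms(1) by (simp_all add: add_pos_pos mult_left_le)
  have "prob ?E \<le> exp (- (t * \<gamma>)) * (1 - \<mu> + \<mu> * exp t) ^ k"
    by (rule chernoff_bound)
  also have "(1 - \<mu> + \<mu> * exp t) ^ k = (1 - \<mu> + \<mu> * exp t) powr real k"
    using b by (simp add: powr_realpow)
  \<comment> \<open>The base is at most 1, so the smaller exponent gives the larger bound.\<close>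
  also have "exp (- (t * \<gamma>)) * \<dots> \<le> exp (- (t * \<gamma>)) * (1 - \<mu> + \<mu> * exp t) powr (x - 1)"
    using b k by (intro mult_left_mono powr_mono') auto
  finally show "prob ?E \<le> exp (- (t * \<gamma>)) * (1 - \<mu> + \<mu> * exp t) powr (x - 1)" .
  fix \<omega> assume \<omega>: "\<omega> \<in> space M" "ereal x \<le> ereal_of_enat (sample_size \<gamma> X \<omega>)"
  then have "enat k < sample_size \<gamma> X \<omega>"
    using k by (cases "sample_size \<gamma> X \<omega>") auto
  then have "(\<Sum>i=1..k. X i \<omega>) < \<gamma>"
    by (rule sum_less_if_less_sample_size)
  then show "\<omega> \<in> ?E"
    using \<omega> assms(1) by (auto intro: mult_left_mono_neg)
qed

lemma early_stopping_event:
  assumes "0 \<le> t" "0 \<le> x"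
  obtains E where "E \<in> events"
    "prob E \<le> exp (- (t * \<gamma>)) * (1 - \<mu> + \<mu> * exp t) powr x"
    "AE \<omega> in M. ereal_of_enat (sample_size \<gamma> X \<omega>) \<le> ereal x \<longrightarrow> \<omega> \<in> E"
proof
  define k where "k = nat \<lfloor>x\<rfloor>"
  have k: "real k \<le> x" "x < real k + 1"
    using assms(2) unfolding k_def by linarith+
  let ?E = "{\<omega> \<in> space M. t * \<gamma> \<le> t * (\<Sum>i=1..k. X i \<omega>)}"
  show "?E \<in> events" by (rule chernoff_bound)
  have b: "1 \<le> 1 - \<mu> + \<mu> * exp t"
    using mu assms(1) by simp
  have "prob ?E \<le> exp (- (t * \<gamma>)) * (1 - \<mu> + \<mu> * exp t) ^ k"
    by (rule chernoff_bound)
  also have "(1 - \<mu> + \<mu> * exp t) ^ k = (1 - \<mu> + \<mu> * exp t) powr real k"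
    using b by (simp add: powr_realpow)
  also have "exp (- (t * \<gamma>)) * \<dots> \<le> exp (- (t * \<gamma>)) * (1 - \<mu> + \<mu> * exp t) powr x"
    using b k by (intro mult_left_mono powr_mono) auto
  finally show "prob ?E \<le> exp (- (t * \<gamma>)) * (1 - \<mu> + \<mu> * exp t) powr x" .
  show "AE \<omega> in M. ereal_of_enat (sample_size \<gamma> X \<omega>) \<le> ereal x \<longrightarrow> \<omega> \<in> ?E"
    using AE_bounded AE_space
  proof eventually_elim
    case (elim \<omega>)
    show ?case
    proof
      assume le: "ereal_of_enat (sample_size \<gamma> X \<omega>) \<le> ereal x"
      then obtain n where n: "sample_size \<gamma> X \<omega> = enat n" "n \<le> k"
        using k by (cases "sample_size \<gamma> X \<omega>") auto
      have "\<gamma> \<le> (\<Sum>i=1..n. X i \<omega>)"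
        using n(1) by (rule sum_ge_if_sample_size_eq)
      \<comment> \<open>Partial sums increase only where the samples are nonnegative, so the
        covering holds almost everywhere.\<close>
      also have "\<dots> \<le> (\<Sum>i=1..k. X i \<omega>)"
        using n(2) elim by (intro sum_mono2) auto
      finally show "\<omega> \<in> ?E"
        using elim assms(1) by (auto intro: mult_left_mono)
    qed
  qed
qed

lemma late_stopping_bound:
  assumes "\<mu> / \<gamma> < \<rho>"
  shows "\<P>(\<omega> in M. ereal_of_enat (sample_size \<gamma> X \<omega>) \<ge> ereal (\<gamma> * (1 + \<rho>) / \<mu>))
    \<le> (1 + \<rho> - \<mu> / \<gamma>) powr ((1 + \<rho> - \<mu> / \<gamma>) * (\<gamma> / \<mu>))
      * ((1 - \<mu>) / (1 + \<rho> - \<mu> / \<gamma> - \<mu>)) powr ((1 + \<rho> - \<mu> / \<gamma> - \<mu>) * (\<gamma> / \<mu>))"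
proof -
  define a where "a = 1 + \<rho> - \<mu> / \<gamma>"
  define t where "t = ln ((1 - \<mu>) / (a - \<mu>))"
  have a: "1 < a" using assms by (simp add: a_def)
  have t: "t \<le> 0" using a mu by (simp add: t_def)
  \<comment> \<open>The term \<open>\<mu> / \<gamma>\<close> in \<open>a\<close> accounts for the
    lost sample.\<close>
  have x: "\<gamma> * (1 + \<rho>) / \<mu> - 1 = a * (\<gamma> / \<mu>)"
    using mu gamma by (simp add: a_def field_simps)
  have "0 \<le> a * (\<gamma> / \<mu>)" using a mu gamma by simp
  then have "1 \<le> \<gamma> * (1 + \<rho>) / \<mu>" using x by linarith
  from late_stopping_event[OF t this] obtain E where E: "E \<in> events"
    "prob E \<le> exp (- (t * \<gamma>)) * (1 - \<mu> + \<mu> * exp t) powr (a * (\<gamma> / \<mu>))"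
    "\<And>\<omega>. \<omega> \<in> space M \<Longrightarrow> ereal (\<gamma> * (1 + \<rho>) / \<mu>) \<le> ereal_of_enat (sample_size \<gamma> X \<omega>) \<Longrightarrow> \<omega> \<in> E"
    unfolding x by metis
  have "\<P>(\<omega> in M. ereal_of_enat (sample_size \<gamma> X \<omega>) \<ge> ereal (\<gamma> * (1 + \<rho>) / \<mu>)) \<le> prob E"
    using E(3) by (intro finite_measure_mono E(1)) auto
  also note E(2)
  also have "exp (- (t * \<gamma>)) * (1 - \<mu> + \<mu> * exp t) powr (a * (\<gamma> / \<mu>))
      = a powr (a * (\<gamma> / \<mu>)) * ((1 - \<mu>) / (a - \<mu>)) powr ((a - \<mu>) * (\<gamma> / \<mu>))"
    unfolding t_def using mu a by (intro chernoff_optimum) auto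
  finally show ?thesis by (simp add: a_def)
qed

lemma early_stopping_bound:
  assumes "0 < \<rho>" "\<rho> < 1 - \<mu>"
  shows "\<P>(\<omega> in M. ereal_of_enat (sample_size \<gamma> X \<omega>) \<le> ereal (\<gamma> * (1 - \<rho>) / \<mu>))
    \<le> (1 - \<rho>) powr ((1 - \<rho>) * (\<gamma> / \<mu>))
      * ((1 - \<mu>) / (1 - \<rho> - \<mu>)) powr ((1 - \<rho> - \<mu>) * (\<gamma> / \<mu>))"
proof -
  define a where "a = 1 - \<rho>"
  define t where "t = ln ((1 - \<mu>) / (a - \<mu>))"
  have a: "\<mu> < a" "a < 1" using assms by (simp_all add: a_def)
  have t: "0 \<le> t" using a mu by (simp add: t_def)
  have x: "\<gamma> * (1 - \<rho>) / \<mu> = a * (\<gamma> / \<mu>)"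
    by (simp add: a_def)
  have "0 \<le> a * (\<gamma> / \<mu>)" using a mu gamma by simp
  from early_stopping_event[OF t this] obtain E where E: "E \<in> events"
    "prob E \<le> exp (- (t * \<gamma>)) * (1 - \<mu> + \<mu> * exp t) powr (a * (\<gamma> / \<mu>))"
    "AE \<omega> in M. ereal_of_enat (sample_size \<gamma> X \<omega>) \<le> ereal (a * (\<gamma> / \<mu>)) \<longrightarrow> \<omega> \<in> E"
    by metis
  have "\<P>(\<omega> in M. ereal_of_enat (sample_size \<gamma> X \<omega>) \<le> ereal (a * (\<gamma> / \<mu>))) \<le> prob E"
    using E(3) by (intro finite_measure_mono_AE E(1)) auto
  also note E(2)
  also have "exp (- (t * \<gamma>)) * (1 - \<mu> + \<mu> * exp t) powr (a * (\<gamma> / \<mu>))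
      = a powr (a * (\<gamma> / \<mu>)) * ((1 - \<mu>) / (a - \<mu>)) powr ((a - \<mu>) * (\<gamma> / \<mu>))"
    unfolding t_def using mu a by (intro chernoff_optimum) auto
  finally show ?thesis unfolding x by (simp add: a_def)
qed

text \<open>A union bound shared by both estimators: stopping by \<open>u\<close> and stopping from
  \<open>v\<close> on yield the two summands of \<open>Q_shift\<close>. The shift \<open>s\<close>
  records how far \<open>(v - 1) * \<mu>\<close> may fall below
  \<open>\<gamma> / (1 - \<epsilon>)\<close>.\<close>

lemma deviation_bound:
  assumes \<epsilon>: "0 < \<epsilon>" "\<epsilon> < 1" and "0 \<le> u" "u * \<mu> \<le> \<gamma> / (1 + \<epsilon>)"
    and "1 \<le> v" "\<gamma> / (1 - \<epsilon>) - s \<le> (v - 1) * \<mu>" "\<gamma> < \<gamma> / (1 - \<epsilon>) - s"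
    and cover: "AE \<omega> in M. P \<omega> \<longrightarrow> ereal_of_enat (sample_size \<gamma> X \<omega>) \<le> ereal u
      \<or> ereal v \<le> ereal_of_enat (sample_size \<gamma> X \<omega>)"
  shows "\<P>(\<omega> in M. P \<omega>) \<le> Q_shift \<epsilon> s \<gamma>"
proof -
  define l where "l = \<gamma> / (1 - \<epsilon>) - s"
  have l: "\<gamma> < l" "l \<le> (v - 1) * \<mu>" using assms by (simp_all add: l_def)
  \<comment> \<open>The optimal \<open>t\<close> for Poisson mean
    \<open>\<gamma> / (1 + \<epsilon>)\<close> at level \<open>\<gamma>\<close>.\<close>
  have "0 \<le> ln (1 + \<epsilon>)" using \<epsilon> by simp
  from early_stopping_event[OF this \<open>0 \<le> u\<close>] obtain E where E: "E \<in> events"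
    "prob E \<le> exp (- (ln (1 + \<epsilon>) * \<gamma>)) * (1 - \<mu> + \<mu> * exp (ln (1 + \<epsilon>))) powr u"
    "AE \<omega> in M. ereal_of_enat (sample_size \<gamma> X \<omega>) \<le> ereal u \<longrightarrow> \<omega> \<in> E"
    by metis
  note E(2)
  also have "exp (- (ln (1 + \<epsilon>) * \<gamma>)) * (1 - \<mu> + \<mu> * exp (ln (1 + \<epsilon>))) powr u
      \<le> exp (u * \<mu> * (exp (ln (1 + \<epsilon>)) - 1) - ln (1 + \<epsilon>) * \<gamma>)"
    using mu \<open>0 \<le> u\<close> by (intro chernoff_le_poisson) auto
  also have "\<dots> \<le> exp (\<gamma> / (1 + \<epsilon>) * \<epsilon> - ln (1 + \<epsilon>) * \<gamma>)"
    using \<epsilon> assms(4) by (simp add: mult_right_mono del: times_divide_eq_left)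
  also have "\<gamma> / (1 + \<epsilon>) * \<epsilon> - ln (1 + \<epsilon>) * \<gamma> = - (\<gamma> * upper_rate \<epsilon>)"
    by (simp add: upper_rate_def algebra_simps)
  finally have early: "prob E \<le> exp (- (\<gamma> * upper_rate \<epsilon>))" .
  \<comment> \<open>The optimal \<open>t\<close> for Poisson mean \<open>l\<close>. As
    \<open>exp t - 1\<close> is negative, the mean \<open>(v - 1) * \<mu>\<close> may be lowered to
    \<open>l\<close>.\<close>
  define t where "t = ln (\<gamma> / l)"
  have exp_t: "exp t = \<gamma> / l" using gamma l by (simp add: t_def)
  have "t \<le> 0" using gamma l by (simp add: t_def)
  from late_stopping_event[OF this \<open>1 \<le> v\<close>] obtain F where F: "F \<in> events"
    "prob F \<le> exp (- (t * \<gamma>)) * (1 - \<mu> + \<mu> * exp t) powr (v - 1)"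
    "\<And>\<omega>. \<omega> \<in> space M \<Longrightarrow> ereal v \<le> ereal_of_enat (sample_size \<gamma> X \<omega>) \<Longrightarrow> \<omega> \<in> F"
    by metis
  note F(2)
  also have "exp (- (t * \<gamma>)) * (1 - \<mu> + \<mu> * exp t) powr (v - 1)
      \<le> exp ((v - 1) * \<mu> * (exp t - 1) - t * \<gamma>)"
    using mu \<open>1 \<le> v\<close> by (intro chernoff_le_poisson) auto
  also have "\<dots> \<le> exp (l * (exp t - 1) - t * \<gamma>)"
    using l gamma by (simp add: exp_t mult_right_mono_neg)
  also have "l * (exp t - 1) - t * \<gamma> = poisson_exponent \<gamma> l"
    using l gamma by (simp add: exp_t) (simp add: t_def poisson_exponent_def ln_div algebra_simps)
  finally have late: "prob F \<le> exp (poisson_exponent \<gamma> l)" .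
  have "AE \<omega> in M. \<omega> \<in> {\<omega> \<in> space M. P \<omega>} \<longrightarrow> \<omega> \<in> E \<union> F"
    using cover E(3) by eventually_elim (use F(3) in blast)
  then have "\<P>(\<omega> in M. P \<omega>) \<le> prob (E \<union> F)"
    using E F by (intro finite_measure_mono_AE) auto
  also have "\<dots> \<le> prob E + prob F"
    using E F by (intro measure_Un_le)
  also have "\<dots> \<le> Q_shift \<epsilon> s \<gamma>"
    unfolding Q_shift_def l_def[symmetric] using early late by linarith
  finally show ?thesis .
qed

section \<open>Deviation of the two estimators\<close>

lemma relative_error_cases:
  assumes "\<epsilon> \<le> \<bar>(m - \<mu>) / \<mu>\<bar>"
  shows "(1 + \<epsilon>) * \<mu> \<le> m \<or> m \<le> (1 - \<epsilon>) * \<mu>"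
proof -
  have "\<epsilon> * \<mu> \<le> \<bar>m - \<mu>\<bar>"
    using assms mu by (simp add: abs_divide le_divide_eq)
  then show ?thesis by (simp add: algebra_simps abs_if split: if_splits)
qed

lemma mu_tilde_deviation:
  assumes \<epsilon>: "0 < \<epsilon>" "\<epsilon> < 1" and "(1 - \<epsilon>) / \<epsilon> < \<gamma>"
  shows "\<P>(\<omega> in M. \<bar>(mu_tilde \<gamma> X \<omega> - \<mu>) / \<mu>\<bar> \<ge> \<epsilon>) \<le> Q_tilde \<epsilon> \<gamma>"
proof -
  define u where "u = \<gamma> / ((1 + \<epsilon>) * \<mu>)"
  define v where "v = \<gamma> / ((1 - \<epsilon>) * \<mu>)"
  have u: "0 \<le> u" "u * \<mu> = \<gamma> / (1 + \<epsilon>)"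
    using \<epsilon> mu gamma by (simp_all add: u_def)
  \<comment> \<open>The lost sample costs \<open>\<mu>\<close>, which is below 1; this is why the
    shift is 1.\<close>
  have v\<mu>: "(v - 1) * \<mu> = \<gamma> / (1 - \<epsilon>) - \<mu>"
    using \<epsilon> mu by (simp add: v_def left_diff_distrib[of _ 1 \<mu>])
  have "(1 - \<epsilon>) * \<mu> \<le> 1 * 1" using \<epsilon> mu by (intro mult_mono) auto
  then have v: "1 \<le> v"
    using \<epsilon> mu gamma by (simp add: v_def le_divide_eq)
  have gap: "\<gamma> < \<gamma> / (1 - \<epsilon>) - 1"
    using threshold_less_iff(1)[of \<epsilon> 1 \<gamma>] assms by simp
  have "ereal_of_enat (sample_size \<gamma> X \<omega>) \<le> ereal u \<or> ereal v \<le> ereal_of_enat (sample_size \<gamma> X \<omega>)"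
    if "\<epsilon> \<le> \<bar>(mu_tilde \<gamma> X \<omega> - \<mu>) / \<mu>\<bar>" for \<omega>
  proof (cases "sample_size \<gamma> X \<omega>")
    case (enat n)
    have "n \<noteq> 0" using sum_ge_if_sample_size_eq[OF enat] gamma by (intro notI) simp
    moreover have "(1 + \<epsilon>) * \<mu> \<le> \<gamma> / n \<or> \<gamma> / n \<le> (1 - \<epsilon>) * \<mu>"
      using relative_error_cases[OF that] by (simp add: mu_tilde_def enat)
    moreover have "0 < (1 + \<epsilon>) * \<mu>" "0 < (1 - \<epsilon>) * \<mu>"
      using \<epsilon> mu by simp_all
    moreover have "p \<le> \<gamma> / n \<or> \<gamma> / n \<le> q \<Longrightarrow> real n \<le> \<gamma> / p \<or> \<gamma> / q \<le> real n"
      if "n \<noteq> 0" "0 < p" "0 < q" for p q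
      using that by (auto simp: field_simps)
    ultimately show ?thesis
      by (simp add: enat u_def v_def del: times_divide_eq_right)
  \<comment> \<open>An infinite sample size lies beyond \<open>v\<close>, in accordance with the
    value 0 of the estimator there.\<close>
  qed simp
  then show ?thesis
    unfolding Q_tilde_eq_Q_shift[OF assms] using \<epsilon> u v v\<mu> gap mu
    by (intro deviation_bound[where u = u and v = v]) auto
qed

text \<open>Samples are at most 1. This keeps the denominator \<open>real n - 1\<close> of
  \<open>mu_hat\<close> at least \<open>\<gamma> - 1\<close>, hence positive.\<close>

lemma AE_sample_size_ge_gamma: "AE \<omega> in M. \<forall>n. sample_size \<gamma> X \<omega> = enat n \<longrightarrow> \<gamma> \<le> real n"
  using AE_bounded
proof eventually_elim
  case (elim \<omega>)
  show ?case
  proof (intro allI impI)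
    fix n assume "sample_size \<gamma> X \<omega> = enat n"
    then have "\<gamma> \<le> (\<Sum>i=1..n. X i \<omega>)" by (rule sum_ge_if_sample_size_eq)
    also have "\<dots> \<le> (\<Sum>i=1..n. 1)" using elim by (intro sum_mono) auto
    finally show "\<gamma> \<le> real n" by simp
  qed
qed

lemma mu_hat_deviation:
  assumes \<epsilon>: "0 < \<epsilon>" "\<epsilon> < 1" and "1 / \<epsilon> < \<gamma>"
  shows "\<P>(\<omega> in M. \<bar>(mu_hat \<gamma> X \<omega> - \<mu>) / \<mu>\<bar> \<ge> \<epsilon>) \<le> Q_hat \<epsilon> \<gamma>"
proof -
  define u where "u = \<gamma> / ((1 + \<epsilon>) * \<mu>)"
  \<comment> \<open>The 1 absorbs the lost sample exactly, so the mean is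
    \<open>(\<gamma> - 1) / (1 - \<epsilon>)\<close> and the shift is
    \<open>1 / (1 - \<epsilon>)\<close>.\<close>
  define v where "v = 1 + (\<gamma> - 1) / ((1 - \<epsilon>) * \<mu>)"
  have u: "0 \<le> u" "u * \<mu> = \<gamma> / (1 + \<epsilon>)"
    using \<epsilon> mu gamma by (simp_all add: u_def)
  have "1 \<le> v" "(v - 1) * \<mu> = (\<gamma> - 1) / (1 - \<epsilon>)"
    using \<epsilon> mu gamma by (simp_all add: v_def)
  then have v: "1 \<le> v" "(v - 1) * \<mu> = \<gamma> / (1 - \<epsilon>) - 1 / (1 - \<epsilon>)"
    by (simp_all add: diff_divide_distrib)
  have gap: "\<gamma> < \<gamma> / (1 - \<epsilon>) - 1 / (1 - \<epsilon>)"
    using threshold_less_iff(1)[of \<epsilon> "1 / (1 - \<epsilon>)" \<gamma>] assms hat_threshold[of \<epsilon>] by simp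
  have cover: "ereal_of_enat (sample_size \<gamma> X \<omega>) \<le> ereal u \<or> ereal v \<le> ereal_of_enat (sample_size \<gamma> X \<omega>)"
    if "\<epsilon> \<le> \<bar>(mu_hat \<gamma> X \<omega> - \<mu>) / \<mu>\<bar>"
      and large: "\<forall>n. sample_size \<gamma> X \<omega> = enat n \<longrightarrow> \<gamma> \<le> real n" for \<omega>
  proof (cases "sample_size \<gamma> X \<omega>")
    case (enat n)
    then have n: "\<gamma> \<le> real n" using large by simp
    have "(1 + \<epsilon>) * \<mu> \<le> (\<gamma> - 1) / (real n - 1) \<or> (\<gamma> - 1) / (real n - 1) \<le> (1 - \<epsilon>) * \<mu>"
      using relative_error_cases[OF that(1)] by (simp add: mu_hat_def enat)
    then show ?thesis
    proof
      define m where "m = (1 + \<epsilon>) * \<mu>"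
      have m: "0 < m" using \<epsilon> mu by (simp add: m_def)
      assume "(1 + \<epsilon>) * \<mu> \<le> (\<gamma> - 1) / (real n - 1)"
      then have le: "m * (real n - 1) \<le> \<gamma> - 1"
        using n gamma by (simp add: m_def le_divide_eq)
      \<comment> \<open>Otherwise fewer than \<open>\<gamma>\<close> samples would have sufficed.\<close>
      have "m \<le> 1"
      proof (rule ccontr)
        assume "\<not> m \<le> 1"
        then have "1 * (real n - 1) < m * (real n - 1)"
          using n gamma by (intro mult_strict_right_mono) auto
        with le n show False by simp
      qed
      \<comment> \<open>Adding \<open>m \<le> 1\<close> to
        \<open>m * (real n - 1) \<le> \<gamma> - 1\<close> recovers the early threshold used for
        \<open>mu_tilde\<close>.\<close>
      with le have "m * real n \<le> \<gamma>" by (simp add: right_diff_distrib)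
      then show ?thesis
        using m by (simp add: enat u_def m_def[symmetric] pos_le_divide_eq mult.commute[of _ m])
    next
      assume "(\<gamma> - 1) / (real n - 1) \<le> (1 - \<epsilon>) * \<mu>"
      then have "(\<gamma> - 1) / ((1 - \<epsilon>) * \<mu>) \<le> real n - 1"
        using n gamma \<epsilon> mu by (simp add: divide_le_eq mult.commute)
      then show ?thesis by (simp add: enat v_def)
    qed
  qed simp
  have "AE \<omega> in M. \<epsilon> \<le> \<bar>(mu_hat \<gamma> X \<omega> - \<mu>) / \<mu>\<bar> \<longrightarrow>
      ereal_of_enat (sample_size \<gamma> X \<omega>) \<le> ereal u \<or> ereal v \<le> ereal_of_enat (sample_size \<gamma> X \<omega>)"
    using AE_sample_size_ge_gamma by eventually_elim (use cover in blast)
  then show ?thesis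
    unfolding Q_hat_eq_Q_shift[OF assms] using \<epsilon> u v gap
    by (intro deviation_bound[where u = u and v = v]) auto
qed

end

theorem theorem1:
  fixes M :: "'a measure" and X :: "nat \<Rightarrow> 'a \<Rightarrow> real" and \<epsilon> \<gamma> \<mu> :: real
  assumes eps: "0 < \<epsilon>" "\<epsilon> < 1"
    and gamma: "\<gamma> > 1"
    and prob: "prob_space M"
    and indep: "prob_space.indep_vars M (\<lambda>_. borel) X {1..}"
    and ident: "\<And>i. i \<ge> 1 \<Longrightarrow> distr M borel (X i) = distr M borel (X 1)"
    and bounded: "\<And>i. i \<ge> 1 \<Longrightarrow> AE \<omega> in M. 0 \<le> X i \<omega> \<and> X i \<omega> \<le> 1"
    and mean: "\<And>i. i \<ge> 1 \<Longrightarrow> (\<integral>\<omega>. X i \<omega> \<partial>M) = \<mu>"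
    and mu: "0 < \<mu>" "\<mu> < 1"
  shows
    "(\<gamma> > (1 - \<epsilon>) / \<epsilon> \<longrightarrow>
        \<P>(\<omega> in M. \<bar>(mu_tilde \<gamma> X \<omega> - \<mu>) / \<mu>\<bar> \<ge> \<epsilon>) \<le> Q_tilde \<epsilon> \<gamma>)
     \<and>
     (\<gamma> > 1 / \<epsilon> \<longrightarrow>
        \<P>(\<omega> in M. \<bar>(mu_hat \<gamma> X \<omega> - \<mu>) / \<mu>\<bar> \<ge> \<epsilon>) \<le> Q_hat \<epsilon> \<gamma>)
     \<and>
     strict_antimono_on {(1 - \<epsilon>) / \<epsilon> <..} (Q_tilde \<epsilon>)
     \<and> (\<forall>\<delta>. 0 < \<delta> \<and> \<delta> < 1 \<longrightarrow> (\<exists>!g. g > (1 - \<epsilon>) / \<epsilon> \<and> Q_tilde \<epsilon> g = \<delta>))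
     \<and>
     strict_antimono_on {1 / \<epsilon> <..} (Q_hat \<epsilon>)
     \<and> (\<forall>\<delta>. 0 < \<delta> \<and> \<delta> < 1 \<longrightarrow> (\<exists>!g. g > 1 / \<epsilon> \<and> Q_hat \<epsilon> g = \<delta>))
     \<and>
     (\<forall>\<delta>. 0 < \<delta> \<and> \<delta> < 1 \<longrightarrow>
        (1 - \<epsilon>) * gamma_hat \<epsilon> \<delta> < gamma_tilde \<epsilon> \<delta>
        \<and> gamma_tilde \<epsilon> \<delta> < gamma_hat \<epsilon> \<delta>
        \<and> gamma_hat \<epsilon> \<delta> < (1 + \<epsilon>) * ln (2 / \<delta>) / ((1 + \<epsilon>) * ln (1 + \<epsilon>) - \<epsilon>)
        \<and> (1 + \<epsilon>) * ln (2 / \<delta>) / ((1 + \<epsilon>) * ln (1 + \<epsilon>) - \<epsilon>)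
            < (1 + \<epsilon>) * ln (2 / \<delta>) / ((2 * ln 2 - 1) * \<epsilon>\<^sup>2)
        \<and> (1 + \<epsilon>) * ln (2 / \<delta>) / ((2 * ln 2 - 1) * \<epsilon>\<^sup>2)
            < 4 * (exp 1 - 2) * (1 + \<epsilon>) * ln (2 / \<delta>) / \<epsilon>\<^sup>2)
     \<and> ((\<lambda>\<delta>. gamma_tilde \<epsilon> \<delta> / (inverse (ln (1 + \<epsilon>) - \<epsilon> / (1 + \<epsilon>)) * ln (2 / \<delta>)))
          \<longlongrightarrow> 1) (at_right 0)
     \<and> (\<forall>\<delta>. 0 < \<delta> \<and> \<delta> < 1 \<longrightarrow>
          ((\<lambda>e. gamma_tilde e \<delta> / (inverse (ln (1 + e) - e / (1 + e)) * ln (2 / \<delta>)))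
            \<longlongrightarrow> 1) (at_right 0))
     \<and>
     (\<forall>\<rho>. \<rho> > \<mu> / \<gamma> \<longrightarrow>
        \<P>(\<omega> in M. ereal_of_enat (sample_size \<gamma> X \<omega>) \<ge> ereal (\<gamma> * (1 + \<rho>) / \<mu>))
        \<le> (1 + \<rho> - \<mu> / \<gamma>) powr ((1 + \<rho> - \<mu> / \<gamma>) * (\<gamma> / \<mu>))
          * ((1 - \<mu>) / (1 + \<rho> - \<mu> / \<gamma> - \<mu>)) powr ((1 + \<rho> - \<mu> / \<gamma> - \<mu>) * (\<gamma> / \<mu>)))
     \<and>
     (\<forall>\<rho>. 0 < \<rho> \<and> \<rho> < 1 - \<mu> \<longrightarrow>
        \<P>(\<omega> in M. ereal_of_enat (sample_size \<gamma> X \<omega>) \<le> ereal (\<gamma> * (1 - \<rho>) / \<mu>))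
        \<le> (1 - \<rho>) powr ((1 - \<rho>) * (\<gamma> / \<mu>))
          * ((1 - \<mu>) / (1 - \<rho> - \<mu>)) powr ((1 - \<rho> - \<mu>) * (\<gamma> / \<mu>)))"
proof -
  interpret prob_space M by (rule prob)
  interpret bounded_sampling M X \<mu> \<gamma>
    by unfold_locales (use indep bounded mean mu gamma in auto)
  show ?thesis
  proof (intro conjI allI impI; (elim conjE)?)
    fix \<delta> :: real assume \<delta>: "0 < \<delta>" "\<delta> < 1"
    show "\<exists>!g. g > (1 - \<epsilon>) / \<epsilon> \<and> Q_tilde \<epsilon> g = \<delta>"
      by (rule Q_tilde_unique_solution[OF eps \<delta>])
    show "\<exists>!g. g > 1 / \<epsilon> \<and> Q_hat \<epsilon> g = \<delta>"
      by (rule Q_hat_unique_solution[OF eps \<delta>])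
    show "(1 - \<epsilon>) * gamma_hat \<epsilon> \<delta> < gamma_tilde \<epsilon> \<delta>"
      by (rule gamma_hat_less_gamma_tilde[OF eps \<delta>])
    show "gamma_tilde \<epsilon> \<delta> < gamma_hat \<epsilon> \<delta>"
      by (rule gamma_tilde_less_gamma_hat[OF eps \<delta>])
    show "gamma_hat \<epsilon> \<delta> < (1 + \<epsilon>) * ln (2 / \<delta>) / ((1 + \<epsilon>) * ln (1 + \<epsilon>) - \<epsilon>)"
      unfolding upper_rate_quotient[OF eps(1)] by (rule gamma_hat_less_bound[OF eps \<delta>])
    have "0 < ln (2 / \<delta>)" using ln_two_div_greater[OF eps \<delta>] by linarith
    note bounds = sample_size_bounds[OF eps this]
    show "(1 + \<epsilon>) * ln (2 / \<delta>) / ((1 + \<epsilon>) * ln (1 + \<epsilon>) - \<epsilon>)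
        < (1 + \<epsilon>) * ln (2 / \<delta>) / ((2 * ln 2 - 1) * \<epsilon>\<^sup>2)"
      by (rule bounds)
    show "(1 + \<epsilon>) * ln (2 / \<delta>) / ((2 * ln 2 - 1) * \<epsilon>\<^sup>2)
        < 4 * (exp 1 - 2) * (1 + \<epsilon>) * ln (2 / \<delta>) / \<epsilon>\<^sup>2"
      by (rule bounds)
    show "((\<lambda>e. gamma_tilde e \<delta> / (inverse (ln (1 + e) - e / (1 + e)) * ln (2 / \<delta>))) \<longlongrightarrow> 1) (at_right 0)"
      using gamma_tilde_limit_epsilon[OF \<delta>] by (simp only: upper_rate_def)
  next
    show "((\<lambda>\<delta>. gamma_tilde \<epsilon> \<delta> / (inverse (ln (1 + \<epsilon>) - \<epsilon> / (1 + \<epsilon>)) * ln (2 / \<delta>))) \<longlongrightarrow> 1) (at_right 0)"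
      using gamma_tilde_limit_delta[OF eps] by (simp only: upper_rate_def)
  qed (rule mu_tilde_deviation mu_hat_deviation Q_tilde_strict_antimono Q_hat_strict_antimono
      late_stopping_bound early_stopping_bound eps; assumption?)+
qed

end
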